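(* Let $\mathcal{H}$ be a complex Hilbert space, $B,C\in\mathcal{B}(\mathcal{H})$ and $\beta\ge0$. Then for all $r\ge1$, $$\begin{aligned}\omega^{4r}\left(\begin{bmatrix}0&B\\ C&0\end{bmatrix}\right)\le{}& \frac{\gamma_1}{16}\max\left\{\left\||C|^{2r}+|B^*|^{2r}\right\|^2,\left\||B|^{2r}+|C^*|^{2r}\right\|^2\right\}\\&+\frac{\gamma_2}{8}\max\left\{\left\||C|^{2r}+|B^*|^{2r}\right\|,\left\||B|^{2r}+|C^*|^{2r}\right\|\right\}\max\left\{\omega^r(BC),\omega^r(CB)\right\},\end{aligned}$$ where $\gamma_1=\frac{2\beta+1}{\beta+1}$ and $\gamma_2=\frac{2\beta+3}{\beta+1}$.
   Context: $\mathcal{B}(\mathcal{H})$ is the algebra of bounded linear operators on $\mathcal{H}$, $\|\cdot\|$ is the operator norm, and $2\times2$ operator matrices act on $\mathcal{H}\oplus\mathcal{H}$. The numerical radius of a bounded operator $A$ on a complex Hilbert space is $\omega(A)=\sup_{\|x\|=1}|\langle Ax,x\rangle|$, and $\omega^s(A)=(\omega(A))^s$. $|A|=(A^*A)^{1/2}$; powers of positive operators are defined by the continuous functional calculus. *)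

theory Defs
  imports "HOL-Analysis.Analysis" "HOL-Computational_Algebra.Polynomial"
begin

text \<open>
  The norm, metric and real inner product of a complex inner product space are those of the
  underlying real inner product space: \<open>inner x y\<close> is the real part of \<open>cinner x y\<close>, so
  positive definiteness and \<open>norm x = sqrt (Re (cinner x x))\<close> come from \<^class>\<open>real_inner\<close>.
  The complex inner product is linear in the first argument.
\<close>

class complex_inner = real_inner +
  fixes scaleC :: "complex \<Rightarrow> 'a \<Rightarrow> 'a"  (infixr "*\<^sub>C" 75)
    and cinner :: "'a \<Rightarrow> 'a \<Rightarrow> complex"
  assumes scaleC_add_right: "a *\<^sub>C (x + y) = a *\<^sub>C x + a *\<^sub>C y"
    and scaleC_add_left: "(a + b) *\<^sub>C x = a *\<^sub>C x + b *\<^sub>C x"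
    and scaleC_scaleC: "a *\<^sub>C b *\<^sub>C x = (a * b) *\<^sub>C x"
    and scaleC_of_real: "complex_of_real t *\<^sub>C x = t *\<^sub>R x"
    and cinner_commute: "cinner x y = cnj (cinner y x)"
    and cinner_add_left: "cinner (x + y) z = cinner x z + cinner y z"
    and cinner_scaleC_left: "cinner (a *\<^sub>C x) y = a * cinner x y"
    and Re_cinner: "Re (cinner x y) = inner x y"

class complex_hilbert = complex_inner + complete_space

instantiation prod :: (complex_inner, complex_inner) complex_inner
begin

definition scaleC_prod_def: "a *\<^sub>C p = (a *\<^sub>C fst p, a *\<^sub>C snd p)"

definition cinner_prod_def: "cinner p q = cinner (fst p) (fst q) + cinner (snd p) (snd q)"

instance
proof
  fix x y :: "'a \<times> 'b"
  show "cinner x y = cnj (cinner y x)"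
    unfolding cinner_prod_def complex_cnj_add by (metis cinner_commute)
qed (simp_all add: scaleC_prod_def cinner_prod_def scaleC_add_right scaleC_add_left
      scaleC_scaleC scaleC_of_real cinner_add_left cinner_scaleC_left Re_cinner
      inner_prod_def scaleR_prod_def algebra_simps)

end

instance prod :: (complex_hilbert, complex_hilbert) complex_hilbert ..

text \<open>
  The type \<open>'a \<Rightarrow>\<^sub>L 'b\<close> consists of the bounded real-linear maps, normed by the operator norm.
  The bounded complex-linear operators form the following subset.
\<close>

definition bounded_ops :: "('a::complex_inner \<Rightarrow>\<^sub>L 'b::complex_inner) set"
  where "bounded_ops = {A. \<forall>c x. blinfun_apply A (c *\<^sub>C x) = c *\<^sub>C blinfun_apply A x}"

definition op_adj :: "('a::complex_inner \<Rightarrow>\<^sub>L 'b::complex_inner) \<Rightarrow> 'b \<Rightarrow>\<^sub>L 'a"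
  where "op_adj A = (THE S. \<forall>x y. cinner (blinfun_apply A x) y = cinner x (blinfun_apply S y))"

lemma norm_scaleC: "norm (c *\<^sub>C x) = cmod c * norm x" for x :: "'a::complex_inner"
proof -
  have "cinner x (c *\<^sub>C x) = cnj c * cinner x x"
    by (metis cinner_commute cinner_scaleC_left complex_cnj_mult)
  then have "cinner (c *\<^sub>C x) (c *\<^sub>C x) = (c * cnj c) * cinner x x"
    by (simp add: cinner_scaleC_left)
  also have "c * cnj c = complex_of_real ((cmod c)\<^sup>2)"
    by (metis complex_norm_square)
  finally have "inner (c *\<^sub>C x) (c *\<^sub>C x) = (cmod c)\<^sup>2 * inner x x"
    by (metis Re_cinner Re_complex_of_real times_complex.simps(1) Im_complex_of_real
        mult_zero_left diff_zero)
  then show ?thesis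
    by (simp add: norm_eq_sqrt_inner real_sqrt_mult)
qed

lift_definition scalar_op :: "complex \<Rightarrow> 'a::complex_inner \<Rightarrow>\<^sub>L 'a" is "\<lambda>c x. c *\<^sub>C x"
proof -
  fix c :: complex
  show "bounded_linear (\<lambda>x::'a. c *\<^sub>C x)"
  proof (rule bounded_linear_intro[where K = "cmod c"])
    fix x y :: 'a and t :: real
    show "c *\<^sub>C (x + y) = c *\<^sub>C x + c *\<^sub>C y"
      by (rule scaleC_add_right)
    show "c *\<^sub>C t *\<^sub>R x = t *\<^sub>R c *\<^sub>C x"
      by (metis scaleC_of_real scaleC_scaleC mult.commute)
    show "norm (c *\<^sub>C x) \<le> norm x * cmod c"
      by (simp add: norm_scaleC)
  qed
qed

definition spectrum :: "('a::complex_inner \<Rightarrow>\<^sub>L 'a) \<Rightarrow> complex set"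
  where "spectrum T = {z. \<not> (\<exists>S \<in> bounded_ops.
    S o\<^sub>L (T - scalar_op z) = id_blinfun \<and> (T - scalar_op z) o\<^sub>L S = id_blinfun)}"

definition poly_op :: "real poly \<Rightarrow> ('a::complex_inner \<Rightarrow>\<^sub>L 'a) \<Rightarrow> 'a \<Rightarrow>\<^sub>L 'a"
  where "poly_op p T = (\<Sum>i\<le>degree p. coeff p i *\<^sub>R (((o\<^sub>L) T ^^ i) id_blinfun))"

text \<open>
  Continuous functional calculus for a self-adjoint \<open>T\<close> (whose spectrum is real) and a real
  function \<open>f\<close> continuous on the spectrum: \<open>cfc f T\<close> is the limit in operator norm of
  \<open>p\<^sub>n(T)\<close> for any real polynomials \<open>p\<^sub>n\<close> converging to \<open>f\<close> uniformly on the spectrum.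
  The value is not meaningful for other \<open>T\<close> or \<open>f\<close>.
\<close>

definition cfc :: "(real \<Rightarrow> real) \<Rightarrow> ('a::complex_inner \<Rightarrow>\<^sub>L 'a) \<Rightarrow> 'a \<Rightarrow>\<^sub>L 'a"
  where "cfc f T = (THE S. \<forall>p :: nat \<Rightarrow> real poly.
    uniform_limit {t. complex_of_real t \<in> spectrum T} (\<lambda>n. poly (p n)) f sequentially
      \<longrightarrow> (\<lambda>n. poly_op (p n) T) \<longlonglongrightarrow> S)"

text \<open>
  Powers of positive operators, for exponents \<open>s > 0\<close>; note that \<open>0 powr s = 0\<close>, so
  \<open>t \<mapsto> t powr s\<close> is continuous on \<open>[0, \<infinity>)\<close>.
\<close>

definition op_powr :: "('a::complex_inner \<Rightarrow>\<^sub>L 'a) \<Rightarrow> real \<Rightarrow> 'a \<Rightarrow>\<^sub>L 'a"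
  where "op_powr T s = cfc (\<lambda>t. t powr s) T"

definition op_abs :: "('a::complex_inner \<Rightarrow>\<^sub>L 'b::complex_inner) \<Rightarrow> 'a \<Rightarrow>\<^sub>L 'a"
  where "op_abs A = op_powr (op_adj A o\<^sub>L A) (1/2)"

text \<open>
  The supremum is taken in \<open>[0, \<infinity>)\<close>; inserting \<open>0\<close> only matters for the zero space, which has
  no unit vectors.
\<close>

definition numerical_radius :: "('a::complex_inner \<Rightarrow>\<^sub>L 'a) \<Rightarrow> real"
  where "numerical_radius A = Sup (insert 0 {cmod (cinner (A x) x) | x. norm x = 1})"

text \<open>The operator matrix with rows \<open>(A, B)\<close> and \<open>(C, D)\<close>.\<close>

lift_definition op_matrix ::
  "('a::complex_inner \<Rightarrow>\<^sub>L 'c::complex_inner) \<Rightarrow> ('b::complex_inner \<Rightarrow>\<^sub>L 'c) \<Rightarrow>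
   ('a \<Rightarrow>\<^sub>L 'd::complex_inner) \<Rightarrow> ('b \<Rightarrow>\<^sub>L 'd) \<Rightarrow> ('a \<times> 'b) \<Rightarrow>\<^sub>L ('c \<times> 'd)"
  is "\<lambda>A B C D p. (A (fst p) + B (snd p), C (fst p) + D (snd p))"
  by (intro bounded_linear_Pair bounded_linear_add bounded_linear_compose[OF _ bounded_linear_fst]
      bounded_linear_compose[OF _ bounded_linear_snd])

end

theory Submission
  imports Defs "HOL-Computational_Algebra.Fundamental_Theorem_Algebra"
begin

text \<open>
  Write \<open>T\<close> for the operator matrix, \<open>M\<close> for the larger of the two norms and \<open>W\<close> for the larger of
  \<open>\<omega>\<^sup>r(BC)\<close> and \<open>\<omega>\<^sup>r(CB)\<close>. Buzano's inequality gives
  \<open>|\<langle>Tz, z\<rangle>|\<^sup>2 \<le> (\<parallel>Tz\<parallel> \<parallel>T\<^sup>*z\<parallel> + |\<langle>T\<^sup>2z, z\<rangle>|) / 2\<close>, where \<open>T\<^sup>2\<close> is the diagonal matrix of \<open>BC\<close> and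
  \<open>CB\<close>. By the McCarthy inequality \<open>(\<parallel>Tz\<parallel> \<parallel>T\<^sup>*z\<parallel>)\<^sup>r \<le> M / 2\<close>, so convexity of the \<open>r\<close>-th power yields
  \<open>\<omega>\<^sup>2\<^sup>r(T) \<le> M / 4 + W / 2\<close>, and also \<open>W \<le> M / 2\<close>. With \<open>s = \<beta> / (\<beta> + 1)\<close> the two coefficients are
  \<open>1 + s\<close> and \<open>3 - s\<close>, and the right-hand side exceeds \<open>(M / 4 + W / 2)\<^sup>2\<close> by
  \<open>(s M / 8 + W / 4) (M / 2 - W) \<ge> 0\<close>.

  Only an order property of the functional calculus is needed: a real polynomial that is nonnegative
  on the real spectrum of a symmetric \<open>T\<close> gives a nonnegative operator. If \<open>m < 0\<close> were the lower bound
  of \<open>p(T)\<close>, then \<open>p(T) - m\<close> would not be bounded below. But \<open>p - m\<close> is a product of real linear and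
  quadratic factors without roots in the spectrum, and each factor gives an operator bounded below.
  McCarthy's inequality then follows by applying this to the tangent of \<open>t \<mapsto> t powr r\<close>.
\<close>

text \<open>With values in a Banach space the bounded operators are complete for the operator norm,
  so the limit in \<open>cfc_tendsto\<close> exists.\<close>

instance complex_hilbert \<subseteq> banach ..

subsection \<open>Coercive operators\<close>

text \<open>
  The solution minimises \<open>inner (Q x) x - 2 * f x\<close>. With \<open>Q\<close> the identity this is the Riesz
  representation theorem; with \<open>f = inner y\<close> it inverts \<open>Q\<close>.
\<close>

lemma coercive_representation:
  fixes Q :: "'a::{real_inner,complete_space} \<Rightarrow>\<^sub>L 'a" and f :: "'a \<Rightarrow> real"
  assumes sym: "\<And>x y. inner (Q x) y = inner x (Q y)"
    and c: "c > 0" and coer: "\<And>x. c * (norm x)\<^sup>2 \<le> inner (Q x) x"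
    and f: "bounded_linear f"
  obtains x where "\<And>z. inner (Q x) z = f z"
proof -
  interpret f: bounded_linear f by (rule f)
  define J where "J x = inner (Q x) x - 2 * f x" for x
  obtain K where K: "\<And>x. norm (f x) \<le> norm x * K"
    using f.bounded by blast
  have low: "- K\<^sup>2 / c \<le> J x" for x
  proof -
    have "0 \<le> (c * norm x - K)\<^sup>2 / c" using c by simp
    also have "\<dots> = c * (norm x)\<^sup>2 - 2 * (norm x * K) + K\<^sup>2 / c"
      using c by (simp add: field_simps power2_eq_square)
    finally have "- K\<^sup>2 / c \<le> c * (norm x)\<^sup>2 - 2 * (norm x * K)" by simp
    also have "\<dots> \<le> J x" using coer[of x] K[of x] by (simp add: J_def abs_le_iff)
    finally show ?thesis .
  qed
  define m where "m = Inf (range J)"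
  have bdd: "bdd_below (range J)" using low by (auto intro!: bdd_belowI)
  have m_le: "m \<le> J x" for x unfolding m_def by (rule cINF_lower[OF bdd]) simp
  have "\<exists>x. J x < m + 1 / real (Suc n)" for n
  proof -
    have "Inf (range J) < m + 1 / real (Suc n)" by (simp add: m_def)
    from cInf_lessD[OF _ this] show ?thesis by auto
  qed
  then obtain X where X: "\<And>n. J (X n) < m + 1 / real (Suc n)" by metis
  \<comment> \<open>Parallelogram law for the quadratic functional: \<open>J\<close> is at least
    \<open>m\<close> at the midpoint, so points with values near \<open>m\<close> lie close together
    and the minimising sequence \<open>X\<close> is Cauchy.\<close>
  have par: "c / 2 * (norm (u - v))\<^sup>2 \<le> J u + J v - 2 * m" for u v
  proof -
    have "inner (Q v) u = inner (Q u) v" by (metis sym inner_commute)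
    then have "2 * J ((1/2) *\<^sub>R (u + v)) = J u + J v - inner (Q (u - v)) (u - v) / 2"
      by (simp add: J_def f.add f.scaleR blinfun.bilinear_simps inner_simps field_simps)
    then show ?thesis using m_le[of "(1/2) *\<^sub>R (u + v)"] coer[of "u - v"] by linarith
  qed
  have "Cauchy X"
  proof (rule metric_CauchyI)
    fix e :: real assume e: "e > 0"
    obtain N where N: "1 / real (Suc N) < c / 4 * e\<^sup>2"
      using c e by (meson divide_pos_pos mult_pos_pos nat_approx_posE zero_less_numeral zero_less_power)
    show "\<exists>M. \<forall>m\<ge>M. \<forall>n\<ge>M. dist (X m) (X n) < e"
    proof (intro exI allI impI)
      fix j k assume jk: "j \<ge> N" "k \<ge> N"
      have "1 / real (Suc i) \<le> 1 / real (Suc N)" if "i \<ge> N" for i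
        using that by (simp add: frac_le)
      from this[OF jk(1)] this[OF jk(2)]
      have "c / 2 * (norm (X j - X k))\<^sup>2 < c / 2 * e\<^sup>2"
        using par[of "X j" "X k"] X[of j] X[of k] N by linarith
      then have "(norm (X j - X k))\<^sup>2 < e\<^sup>2" using c by simp
      then show "dist (X j) (X k) < e"
        using e by (simp add: dist_norm power_less_imp_less_base)
    qed
  qed
  then obtain x where x: "X \<longlonglongrightarrow> x" using Cauchy_convergent convergent_def by blast
  have "(\<lambda>n. J (X n)) \<longlonglongrightarrow> J x"
    unfolding J_def by (intro tendsto_intros f.tendsto x)
  moreover have "(\<lambda>n. m + 1 / real (Suc n)) \<longlonglongrightarrow> m + 0"
    by (intro tendsto_intros LIMSEQ_Suc lim_1_over_n)
  ultimately have "J x \<le> m + 0"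
    by (rule LIMSEQ_le) (use X less_imp_le in blast)
  then have min: "J x \<le> J y" for y using m_le[of y] by simp
  show ?thesis
  proof (rule that)
    fix z
    define a b where "a = inner (Q z) z" and "b = inner (Q x) z - f z"
    have a: "a \<ge> 0" using coer[of z] c unfolding a_def
      by (smt (verit) mult_nonneg_nonneg zero_le_power2)
    have "inner (Q z) x = inner (Q x) z" by (metis sym inner_commute)
    then have "J (x + s *\<^sub>R z) = J x + s\<^sup>2 * a + 2 * s * b" for s
      by (simp add: J_def a_def b_def f.add f.scaleR blinfun.bilinear_simps inner_simps
          algebra_simps power2_eq_square)
    then have "0 \<le> s\<^sup>2 * a + 2 * s * b" for s
      using min[of "x + s *\<^sub>R z"] by simp
    \<comment> \<open>This step away from the minimiser turns the bound into
      \<open>0 \<le> - s\<^sup>2 * (a + 2)\<close>. Dividing by \<open>a + 1\<close> instead of the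
      optimal \<open>a\<close> also covers \<open>a = 0\<close>.\<close>
    moreover define s where "s = - b / (a + 1)"
    ultimately have "0 \<le> s\<^sup>2 * a + 2 * s * b" by blast
    moreover have b: "b = - s * (a + 1)" using a by (simp add: s_def)
    ultimately have "s\<^sup>2 * (a + 2) \<le> 0" by (simp add: power2_eq_square algebra_simps)
    then have "s = 0" using a by (auto simp: mult_le_0_iff)
    then have "b = 0" by (simp add: b)
    then show "inner (Q x) z = f z" by (simp add: b_def)
  qed
qed

subsection \<open>Polynomials of a symmetric operator\<close>

abbreviation real_spectrum :: "('a::complex_inner \<Rightarrow>\<^sub>L 'a) \<Rightarrow> real set"
  where "real_spectrum T \<equiv> {t. complex_of_real t \<in> spectrum T}"

text \<open>The real inner product fits polynomials with real coefficients; for complex-linear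
  operators this is ordinary self-adjointness.\<close>

definition symmetric_op :: "('a::real_inner \<Rightarrow>\<^sub>L 'a) \<Rightarrow> bool"
  where "symmetric_op T \<longleftrightarrow> (\<forall>x y. inner (T x) y = inner x (T y))"

lemma symmetric_opD: "symmetric_op T \<Longrightarrow> inner (T x) y = inner x (T y)"
  by (simp add: symmetric_op_def)

lemma scalar_op_of_real: "scalar_op (complex_of_real t) = t *\<^sub>R id_blinfun"
  by (rule blinfun_eqI) (simp add: scalar_op.rep_eq scaleC_of_real blinfun.bilinear_simps)

text \<open>Padding with zero coefficients brings polynomials of different degrees to one index
  range.\<close>

lemma poly_op_sum:
  assumes "degree p \<le> n"
  shows "poly_op p T = (\<Sum>i\<le>n. coeff p i *\<^sub>R (((o\<^sub>L) T ^^ i) id_blinfun))"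
  unfolding poly_op_def using assms
  by (intro sum.mono_neutral_left) (auto simp: coeff_eq_0)

lemma poly_op_add: "poly_op (p + q) T = poly_op p T + poly_op q T"
  using degree_add_le_max[of p q]
  by (simp add: poly_op_sum[of _ "max (degree p) (degree q)"] scaleR_left_distrib sum.distrib)

lemma poly_op_smult: "poly_op (smult a p) T = a *\<^sub>R poly_op p T"
  by (simp add: poly_op_sum[of _ "degree p"] degree_smult_le scaleR_sum_right)

lemma poly_op_0 [simp]: "poly_op 0 T = 0"
  by (simp add: poly_op_def)

lemma poly_op_diff: "poly_op (p - q) T = poly_op p T - poly_op q T"
  using poly_op_add[of "p - q" q T] by simp

text \<open>Horner's rule: the basis for inductions over \<open>pCons\<close> and for evaluating
  explicit polynomials.\<close>

lemma poly_op_pCons: "poly_op (pCons a p) T = a *\<^sub>R id_blinfun + (T o\<^sub>L poly_op p T)"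
proof -
  have "poly_op (pCons a p) T =
      (\<Sum>i\<le>Suc (degree p). coeff (pCons a p) i *\<^sub>R (((o\<^sub>L) T ^^ i) id_blinfun))"
    by (rule poly_op_sum) (simp add: degree_pCons_le)
  also have "\<dots> = a *\<^sub>R id_blinfun + (T o\<^sub>L poly_op p T)"
    by (subst sum.atMost_Suc_shift)
      (simp add: poly_op_def bounded_bilinear.sum_right[OF bounded_bilinear_blinfun_compose]
        bounded_bilinear.scaleR_right[OF bounded_bilinear_blinfun_compose])
  finally show ?thesis .
qed

lemma poly_op_mult: "poly_op (p * q) T = poly_op p T o\<^sub>L poly_op q T"
proof (induction p)
  case 0
  then show ?case by simp
next
  case (pCons a p)
  then show ?case
    by (auto intro!: blinfun_eqI simp: poly_op_add poly_op_smult poly_op_pCons blinfun.bilinear_simps)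
qed

lemma symmetric_op_poly_op:
  assumes "symmetric_op T"
  shows "symmetric_op (poly_op p T)"
proof -
  \<comment> \<open>Moving \<open>T\<close> and \<open>poly_op p T\<close> across the inner product
    reverses their order, so they have to commute.\<close>
  have comm: "T (poly_op p T x) = poly_op p T (T x)" for p x
    by (induction p) (simp_all add: poly_op_pCons blinfun.bilinear_simps)
  show ?thesis
  proof (induction p)
    case (pCons a p)
    then show ?case using assms
      by (simp add: symmetric_op_def poly_op_pCons blinfun.bilinear_simps inner_simps comm)
  qed (simp add: symmetric_op_def)
qed

lemma bounded_below_off_spectrum:
  fixes T :: "'a::complex_inner \<Rightarrow>\<^sub>L 'a"
  assumes "t \<notin> real_spectrum T"
  obtains c where "c > 0" "\<And>x. c * norm x \<le> norm (T x - t *\<^sub>R x)"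
proof -
  obtain S where S: "S o\<^sub>L (T - t *\<^sub>R id_blinfun) = id_blinfun"
    using assms by (auto simp: spectrum_def scalar_op_of_real)
  \<comment> \<open>The added 1 keeps \<open>K\<close> positive when \<open>S = 0\<close>, as on the
    zero space.\<close>
  define K where "K = norm S + 1"
  have K: "K > 0" by (simp add: K_def add_nonneg_pos)
  have "norm x \<le> K * norm (T x - t *\<^sub>R x)" for x
  proof -
    have "x = S (T x - t *\<^sub>R x)"
      using arg_cong[OF S, of "\<lambda>S. blinfun_apply S x"] by (simp add: blinfun.bilinear_simps)
    then have "norm x \<le> norm S * norm (T x - t *\<^sub>R x)" by (metis norm_blinfun)
    also have "\<dots> \<le> K * norm (T x - t *\<^sub>R x)" by (simp add: K_def mult_right_mono)
    finally show ?thesis .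
  qed
  then show ?thesis using K
    by (intro that[of "1 / K"]) (auto simp: field_simps)
qed

section \<open>Quadratic factors of real polynomials\<close>

lemma map_poly_of_real_add:
  "map_poly complex_of_real (p + q) = map_poly complex_of_real p + map_poly complex_of_real q"
  by (rule poly_eqI) (simp add: coeff_map_poly)

lemma poly_map_poly_of_real_mult:
  "poly (map_poly complex_of_real (p * q)) z =
    poly (map_poly complex_of_real p) z * poly (map_poly complex_of_real q) z"
proof (induction p)
  case (pCons a p)
  have "map_poly complex_of_real (smult a q) = smult (complex_of_real a) (map_poly complex_of_real q)"
    by (rule poly_eqI) (simp add: coeff_map_poly)
  with pCons show ?case
    by (simp add: map_poly_pCons map_poly_of_real_add algebra_simps)
qed simp

text \<open>The divisor has the roots \<open>z\<close> and \<open>cnj z\<close>. The remainder has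
  real coefficients and degree at most 1, so vanishing at a nonreal \<open>z\<close> makes it
  zero.\<close>

lemma quadratic_dvd_of_nonreal_root:
  fixes q :: "real poly"
  assumes root: "poly (map_poly complex_of_real q) z = 0" and z: "Im z \<noteq> 0"
  shows "[:(Re z)\<^sup>2 + (Im z)\<^sup>2, - 2 * Re z, 1:] dvd q"
proof -
  define d where "d = [:(Re z)\<^sup>2 + (Im z)\<^sup>2, - 2 * Re z, 1:]"
  define e where "e = q mod d"
  have dz: "poly (map_poly complex_of_real d) z = 0"
    by (simp add: d_def map_poly_pCons complex_eq_iff power2_eq_square algebra_simps)
  have split: "q = d * (q div d) + e" by (simp add: e_def)
  have "poly (map_poly complex_of_real q) z = poly (map_poly complex_of_real e) z"
    by (subst split) (simp only: map_poly_of_real_add poly_map_poly_of_real_mult poly_add dz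
        mult_zero_left add_0_left)
  then have ez: "poly (map_poly complex_of_real e) z = 0" using root by simp
  have "degree e \<le> 1"
  proof (cases "e = 0")
    case False
    then have "degree e < degree d" unfolding e_def
      by (intro degree_mod_less') (auto simp: d_def)
    then show ?thesis by (simp add: d_def)
  qed simp
  then have "e = [:coeff e 0, coeff e 1:]"
    by (intro poly_eqI) (auto simp: coeff_pCons coeff_eq_0 split: nat.split)
  then obtain a b where e: "e = [:a, b:]" by blast
  have "poly (map_poly complex_of_real [:a, b:]) z = complex_of_real a + z * complex_of_real b"
    by (simp add: map_poly_pCons)
  then have lin: "complex_of_real a + z * complex_of_real b = 0"
    using ez by (simp only: e)
  from arg_cong[OF lin, of Im] have "b = 0" using z by simp
  moreover from arg_cong[OF lin, of Re] this have "a = 0" by simp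
  ultimately have "e = 0" by (simp add: e)
  then have "q mod d = 0" by (simp add: e_def)
  then show ?thesis unfolding d_def by (rule dvd_eq_mod_eq_0[THEN iffD2])
qed

text \<open>Induction on the degree: a complex root of \<open>q\<close> yields a real linear factor,
  bounded below because its root lies off the spectrum, or a real quadratic factor, bounded below by
  symmetry of \<open>T\<close>.\<close>

lemma poly_op_bounded_below:
  fixes T :: "'a::complex_inner \<Rightarrow>\<^sub>L 'a"
  assumes T: "symmetric_op T" and "q \<noteq> 0"
    and "\<And>t. t \<in> real_spectrum T \<Longrightarrow> poly q t \<noteq> 0"
  shows "\<exists>c>0. \<forall>x. c * norm x \<le> norm (poly_op q T x)"
  using assms(2,3)
proof (induction "degree q" arbitrary: q rule: less_induct)
  case less
  \<comment> \<open>Lower bounds multiply under composition, so it suffices to split off one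
    nonconstant factor that has such a bound.\<close>
  have step: ?case if "q = d * q'" "degree d > 0" "c > 0"
    "\<And>x. c * norm x \<le> norm (poly_op d T x)" for d q' c
  proof -
    have "q' \<noteq> 0" "d \<noteq> 0" using less.prems that by auto
    then have "degree q' < degree q" using that by (simp add: degree_mult_eq)
    moreover have "\<And>t. t \<in> real_spectrum T \<Longrightarrow> poly q' t \<noteq> 0"
      using less.prems(2) that(1) by auto
    ultimately obtain c' where c': "c' > 0" "\<And>x. c' * norm x \<le> norm (poly_op q' T x)"
      using less.hyps \<open>q' \<noteq> 0\<close> by blast
    have "(c * c') * norm x \<le> norm (poly_op q T x)" for x
    proof -
      have "c * (c' * norm x) \<le> c * norm (poly_op q' T x)"
        using c'(2) that(3) by simp
      also have "\<dots> \<le> norm (poly_op q T x)"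
        using that(4)[of "poly_op q' T x"] by (simp add: that(1) poly_op_mult)
      finally show ?thesis by (simp add: mult.assoc)
    qed
    then show ?case using c'(1) that(3) by (intro exI[of _ "c * c'"]) auto
  qed
  show ?case
  proof (cases "degree q = 0")
    case True
    then obtain a where "q = [:a:]" by (metis degree_eq_zeroE)
    then show ?thesis using less.prems(1)
      by (intro exI[of _ "\<bar>a\<bar>"]) (simp add: poly_op_pCons blinfun.bilinear_simps)
  next
    case False
    have "degree (map_poly complex_of_real q) = degree q" by (simp add: degree_map_poly)
    then have "\<not> constant (poly (map_poly complex_of_real q))"
      using False by (simp add: constant_degree)
    then obtain z where z: "poly (map_poly complex_of_real q) z = 0"
      using fundamental_theorem_of_algebra by blast
    show ?thesis
    proof (cases "Im z = 0")
      case True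
      have "poly (map_poly complex_of_real q) (complex_of_real s) = complex_of_real (poly q s)" for s
        by (induction q) (simp_all add: map_poly_pCons)
      then have root: "poly q (Re z) = 0" using z True
        by (metis complex_eq_iff Re_complex_of_real Im_complex_of_real of_real_eq_0_iff)
      then obtain q' where "q = [:- Re z, 1:] * q'"
        by (metis dvdE poly_eq_0_iff_dvd)
      moreover have "Re z \<notin> real_spectrum T" using root less.prems(2) by blast
      then obtain c where "c > 0" "\<And>x. c * norm x \<le> norm (T x - Re z *\<^sub>R x)"
        using bounded_below_off_spectrum by blast
      ultimately show ?thesis
        by (intro step[of "[:- Re z, 1:]" q' c])
          (simp_all add: poly_op_pCons blinfun.bilinear_simps)
    next
      case False
      define a b where "a = Re z" and "b = Im z"
      obtain q' where q': "q = [:a\<^sup>2 + b\<^sup>2, - 2 * a, 1:] * q'"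
        using quadratic_dvd_of_nonreal_root[OF z False] unfolding a_def b_def by (metis dvdE)
      show ?thesis
      proof (rule step[OF q'])
        show "b\<^sup>2 > 0" using False by (simp add: b_def)
        fix x
        \<comment> \<open>The factor is \<open>(t - a)\<^sup>2 + b\<^sup>2\<close>, so by symmetry
          its quadratic form is \<open>(norm (T x - a *\<^sub>R x))\<^sup>2 + b\<^sup>2 * (norm
          x)\<^sup>2\<close>.\<close>
        let ?D = "poly_op [:a\<^sup>2 + b\<^sup>2, - 2 * a, 1:] T"
        have "b\<^sup>2 * (norm x)\<^sup>2 \<le> (norm (T x - a *\<^sub>R x))\<^sup>2 + b\<^sup>2 * (norm x)\<^sup>2" by simp
        also have "(norm (T x - a *\<^sub>R x))\<^sup>2 = inner (T x) (T x) - 2 * a * inner (T x) x + a\<^sup>2 * inner x x"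
          unfolding power2_norm_eq_inner
          by (simp add: inner_simps inner_commute[of x "T x"] power2_eq_square algebra_simps)
        also have "\<dots> + b\<^sup>2 * (norm x)\<^sup>2 = inner (?D x) x"
          unfolding power2_norm_eq_inner
          by (simp add: poly_op_pCons blinfun.bilinear_simps inner_simps
              symmetric_opD[OF T, of "T x" x] inner_commute[of x "T (T x)"] algebra_simps)
        also have "\<dots> \<le> norm (?D x) * norm x" by (rule norm_cauchy_schwarz)
        finally have "(b\<^sup>2 * norm x) * norm x \<le> norm (?D x) * norm x"
          by (simp add: power2_eq_square mult.assoc)
        then show "b\<^sup>2 * norm x \<le> norm (?D x)"
          by (cases "x = 0") auto
      qed simp
    qed
  qed
qed

text \<open>Here \<open>m\<close> is the infimum of the Rayleigh quotients, a nonempty set thanks to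
  \<open>x0\<close>. If \<open>S - m\<close> were bounded below by \<open>c\<close>, all quotients
  would be at least \<open>m + c\<^sup>2 / K\<close>.\<close>

lemma approximate_eigenvalue_at_lower_bound:
  fixes S :: "'a::real_inner \<Rightarrow>\<^sub>L 'a"
  assumes S: "symmetric_op S" and x0: "x0 \<noteq> 0"
  obtains m where "m * (norm x0)\<^sup>2 \<le> inner (S x0) x0"
    "\<not> (\<exists>c>0. \<forall>x. c * norm x \<le> norm (S x - m *\<^sub>R x))"
proof -
  define R where "R = (\<lambda>x. inner (S x) x / (norm x)\<^sup>2) ` {x. x \<noteq> 0}"
  define m where "m = Inf R"
  have "- norm S \<le> inner (S x) x / (norm x)\<^sup>2" if "x \<noteq> 0" for x
  proof -
    have "\<bar>inner (S x) x\<bar> \<le> norm (S x) * norm x" by (rule Cauchy_Schwarz_ineq2)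
    also have "\<dots> \<le> norm S * (norm x)\<^sup>2"
      using mult_right_mono[OF norm_blinfun[of S x] norm_ge_zero[of x]]
      by (simp add: power2_eq_square mult.assoc)
    finally show ?thesis using that by (simp add: field_simps)
  qed
  then have bdd: "bdd_below R" unfolding R_def by (intro bdd_belowI2) auto
  have le: "m * (norm x)\<^sup>2 \<le> inner (S x) x" for x
  proof (cases "x = 0")
    case False
    then have "m \<le> inner (S x) x / (norm x)\<^sup>2"
      unfolding m_def by (intro cInf_lower[OF _ bdd]) (auto simp: R_def)
    then show ?thesis using False by (simp add: field_simps)
  qed simp
  have "\<not> (\<exists>c>0. \<forall>x. c * norm x \<le> norm (S x - m *\<^sub>R x))"
  proof
    assume "\<exists>c>0. \<forall>x. c * norm x \<le> norm (S x - m *\<^sub>R x)"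
    then obtain c where c: "c > 0" "\<And>x. c * norm x \<le> norm (S x - m *\<^sub>R x)" by blast
    define Q where "Q = S - m *\<^sub>R id_blinfun"
    have Q: "Q x = S x - m *\<^sub>R x" for x by (simp add: Q_def blinfun.bilinear_simps)
    have symQ: "inner (Q x) y = inner x (Q y)" for x y
      using S by (simp add: Q symmetric_opD inner_simps)
    have pos: "0 \<le> inner (Q x) x" for x
      using le[of x] by (simp add: Q inner_simps power2_norm_eq_inner)
    define K where "K = norm Q + 1"
    have K: "K > 0" by (simp add: K_def add_nonneg_pos)
    have "m + c\<^sup>2 / K \<le> inner (S x) x / (norm x)\<^sup>2" if "x \<noteq> 0" for x
    proof -
      have "inner (Q (Q x)) (Q x) \<le> norm (Q (Q x)) * norm (Q x)" by (rule norm_cauchy_schwarz)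
      also have "\<dots> \<le> (K * norm (Q x)) * norm (Q x)"
        using norm_blinfun[of Q "Q x"] K_def
        by (intro mult_right_mono) (auto simp: algebra_simps intro: order_trans)
      finally have QQ: "inner (Q (Q x)) (Q x) \<le> K * (norm (Q x))\<^sup>2"
        by (simp add: power2_eq_square)
      \<comment> \<open>Positivity of \<open>Q\<close> at this test vector gives
        \<open>(norm (Q x))\<^sup>2 / K \<le> inner (Q x) x\<close> without a square root of
        \<open>Q\<close>.\<close>
      have "0 \<le> inner (Q (x - (1/K) *\<^sub>R Q x)) (x - (1/K) *\<^sub>R Q x)" by (rule pos)
      also have "\<dots> = inner (Q x) x - 2 / K * (norm (Q x))\<^sup>2 + inner (Q (Q x)) (Q x) / K\<^sup>2"
        by (simp add: blinfun.bilinear_simps inner_simps symQ[of "Q x" x] dot_square_norm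
            power2_eq_square algebra_simps)
      also have "\<dots> \<le> inner (Q x) x - 2 / K * (norm (Q x))\<^sup>2 + K * (norm (Q x))\<^sup>2 / K\<^sup>2"
        using QQ K by (simp add: divide_right_mono)
      also have "\<dots> = inner (Q x) x - (norm (Q x))\<^sup>2 / K"
        using K by (simp add: field_simps power2_eq_square)
      finally have "(norm (Q x))\<^sup>2 / K \<le> inner (Q x) x" by simp
      moreover have "(c * norm x)\<^sup>2 \<le> (norm (Q x))\<^sup>2"
        using c(2)[of x] c(1) by (intro power_mono) (auto simp: Q)
      then have "(c * norm x)\<^sup>2 / K \<le> (norm (Q x))\<^sup>2 / K" using K by (simp add: divide_right_mono)
      ultimately have "m * (norm x)\<^sup>2 + c\<^sup>2 / K * (norm x)\<^sup>2 \<le> inner (S x) x"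
        by (simp add: Q inner_simps power2_norm_eq_inner power_mult_distrib)
      then show ?thesis using that by (simp add: field_simps)
    qed
    then have "m + c\<^sup>2 / K \<le> Inf R"
      using x0 unfolding R_def by (intro cINF_greatest) auto
    moreover have "c\<^sup>2 / K > 0" using c(1) K by simp
    ultimately show False by (simp add: m_def)
  qed
  with le show ?thesis by (intro that)
qed

lemma poly_op_nonneg:
  fixes T :: "'a::complex_inner \<Rightarrow>\<^sub>L 'a"
  assumes T: "symmetric_op T" and nonneg: "\<And>t. t \<in> real_spectrum T \<Longrightarrow> 0 \<le> poly p t"
  shows "0 \<le> inner (poly_op p T x) x"
proof (rule ccontr)
  assume neg: "\<not> 0 \<le> inner (poly_op p T x) x"
  then have x: "x \<noteq> 0" by auto
  \<comment> \<open>A point of the spectrum is needed below to exclude that \<open>p - m\<close> is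
    the zero polynomial. It exists because \<open>T\<close> minus its own lower bound is not bounded
    below.\<close>
  have ne: "real_spectrum T \<noteq> {}"
  proof
    assume empty: "real_spectrum T = {}"
    obtain m where "\<not> (\<exists>c>0. \<forall>x. c * norm x \<le> norm (T x - m *\<^sub>R x))"
      using approximate_eigenvalue_at_lower_bound[OF T x] by blast
    moreover have "\<exists>c>0. \<forall>x. c * norm x \<le> norm (poly_op [:- m, 1:] T x)"
      using empty by (intro poly_op_bounded_below[OF T]) auto
    then have "\<exists>c>0. \<forall>x. c * norm x \<le> norm (T x - m *\<^sub>R x)"
      by (simp add: poly_op_pCons blinfun.bilinear_simps)
    ultimately show False by contradiction
  qed
  obtain m where m: "m * (norm x)\<^sup>2 \<le> inner (poly_op p T x) x"
    "\<not> (\<exists>c>0. \<forall>y. c * norm y \<le> norm (poly_op p T y - m *\<^sub>R y))"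
    using approximate_eigenvalue_at_lower_bound[OF symmetric_op_poly_op[OF T] x] by blast
  have m_neg: "m < 0"
  proof (rule ccontr)
    assume "\<not> m < 0"
    then have "0 \<le> m * (norm x)\<^sup>2" by simp
    with m(1) neg show False by linarith
  qed
  have nz: "poly (p - [:m:]) t \<noteq> 0" if "t \<in> real_spectrum T" for t
    using nonneg[OF that] m_neg by simp
  obtain t where "t \<in> real_spectrum T" using ne by blast
  from nz[OF this] have "p - [:m:] \<noteq> 0" by (metis poly_0)
  from poly_op_bounded_below[OF T this nz]
  have "\<exists>c>0. \<forall>y. c * norm y \<le> norm (poly_op (p - [:m:]) T y)" .
  then have "\<exists>c>0. \<forall>y. c * norm y \<le> norm (poly_op p T y - m *\<^sub>R y)"
    by (simp add: poly_op_diff poly_op_pCons blinfun.bilinear_simps)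
  with m(2) show False by contradiction
qed

text \<open>Apply \<open>poly_op_nonneg\<close> to \<open>e\<^sup>2 - p\<^sup>2\<close>. The
  estimate turns uniform convergence on the spectrum into convergence in operator norm.\<close>

lemma norm_poly_op_le:
  fixes T :: "'a::complex_inner \<Rightarrow>\<^sub>L 'a"
  assumes T: "symmetric_op T" and e: "e \<ge> 0"
    and bound: "\<And>t. t \<in> real_spectrum T \<Longrightarrow> \<bar>poly p t\<bar> \<le> e"
  shows "norm (poly_op p T) \<le> e"
proof (rule norm_blinfun_bound[OF e])
  fix x
  have "0 \<le> inner (poly_op ([:e\<^sup>2:] - p * p) T x) x"
  proof (rule poly_op_nonneg[OF T])
    fix t assume "t \<in> real_spectrum T"
    from power_mono[OF bound[OF this], of 2] have "(poly p t)\<^sup>2 \<le> e\<^sup>2" by simp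
    then show "0 \<le> poly ([:e\<^sup>2:] - p * p) t"
      by (simp only: poly_diff poly_mult power2_eq_square) simp
  qed
  moreover have "inner (poly_op p T (poly_op p T x)) x = (norm (poly_op p T x))\<^sup>2"
    by (simp only: symmetric_opD[OF symmetric_op_poly_op[OF T], of p "poly_op p T x" x] dot_square_norm)
  ultimately have "(norm (poly_op p T x))\<^sup>2 \<le> (e * norm x)\<^sup>2"
    by (simp add: poly_op_diff poly_op_pCons poly_op_mult blinfun.bilinear_simps inner_diff_left
        dot_square_norm power_mult_distrib)
  then show "norm (poly_op p T x) \<le> e * norm x"
    by (rule power2_le_imp_le) (simp add: e)
qed

subsection \<open>Complex inner products and adjoints\<close>

lemma cinner_scaleC_right: "cinner x (c *\<^sub>C y) = cnj c * cinner x y"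
  by (metis cinner_commute cinner_scaleC_left complex_cnj_mult)

lemma Im_cinner: "Im (cinner x y) = inner ((- \<i>) *\<^sub>C x) y"
  by (simp add: Re_cinner[symmetric] cinner_scaleC_left)

lemma bounded_opsD: "A \<in> bounded_ops \<Longrightarrow> blinfun_apply A (c *\<^sub>C x) = c *\<^sub>C blinfun_apply A x"
  by (simp add: bounded_ops_def)

lemma inner_eqI: "(\<And>z. inner x z = inner y z) \<Longrightarrow> x = y"
  by (rule vector_eq_rdot[THEN iffD1]) blast

lemma bounded_opsI:
  assumes "\<And>c x y. inner (blinfun_apply A (c *\<^sub>C x)) y = inner (c *\<^sub>C blinfun_apply A x) y"
  shows "A \<in> bounded_ops"
  unfolding bounded_ops_def using assms by (blast intro: inner_eqI)

lemma inner_scaleC_swap: "inner (c *\<^sub>C x) y = inner x (cnj c *\<^sub>C y)"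
  by (simp add: Re_cinner[symmetric] cinner_scaleC_left cinner_scaleC_right)

text \<open>A unimodular factor makes the product real and nonnegative; then the real Cauchy-Schwarz
  inequality applies.\<close>

lemma norm_cinner_le: "cmod (cinner x y) \<le> norm x * norm y"
proof (cases "cinner x y = 0")
  case False
  define c where "c = cnj (cinner x y) / cmod (cinner x y)"
  have c: "cmod c = 1" using False by (simp add: c_def norm_divide)
  have "c * cinner x y = complex_of_real (cmod (cinner x y))"
    using False by (simp add: c_def field_simps complex_norm_square[symmetric] power2_eq_square)
  then have "cmod (cinner x y) = inner (c *\<^sub>C x) y"
    by (simp add: Re_cinner[symmetric] cinner_scaleC_left)
  also have "\<dots> \<le> norm (c *\<^sub>C x) * norm y" by (rule norm_cauchy_schwarz)
  finally show ?thesis by (simp add: norm_scaleC c)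
qed simp

text \<open>Imaginary parts are real inner products with \<open>- \<i>\<close> in the first
  argument, and complex linearity moves this factor through \<open>A\<close>.\<close>

lemma cinner_adjoint_of_inner:
  assumes A: "A \<in> bounded_ops" and S: "\<And>x. inner (blinfun_apply A x) y = inner x z"
  shows "cinner (blinfun_apply A x) y = cinner x z"
  by (rule complex_eqI) (simp_all add: Re_cinner S Im_cinner bounded_opsD[OF A, symmetric])

text \<open>Riesz representation of \<open>inner (A x) y\<close> as a functional of \<open>x\<close>
  gives a real adjoint, which \<open>cinner_adjoint_of_inner\<close> upgrades.\<close>

lemma op_adj_exists:
  fixes A :: "'a::complex_hilbert \<Rightarrow>\<^sub>L 'b::complex_hilbert"
  assumes A: "A \<in> bounded_ops"
  shows "\<exists>S. \<forall>x y. cinner (A x) y = cinner x (blinfun_apply S y)"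
proof -
  have "\<exists>z. \<forall>x. inner (A x) y = inner x z" for y
  proof -
    have "bounded_linear (\<lambda>x. inner (A x) y)"
      by (intro bounded_linear_intros)
    then obtain z where "\<And>x. inner (id_blinfun z :: 'a) x = inner (A x) y"
      by (rule coercive_representation[of id_blinfun 1, rotated 3])
        (auto simp: power2_norm_eq_inner)
    then show ?thesis by (metis blinfun_apply_id_blinfun inner_commute)
  qed
  then obtain S where S: "\<And>x y. inner (A x) y = inner x (S y)" by metis
  have "bounded_linear S"
  proof (rule bounded_linear_intro)
    fix u v :: 'b and t :: real
    have S': "inner (S y) x = inner y (A x)" for x y by (metis S inner_commute)
    show "S (u + v) = S u + S v" by (rule inner_eqI) (simp add: S' inner_add_left)
    show "S (t *\<^sub>R v) = t *\<^sub>R S v" by (rule inner_eqI) (simp add: S')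
    have "(norm (S v))\<^sup>2 = inner (A (S v)) v" by (simp add: S power2_norm_eq_inner)
    also have "\<dots> \<le> norm (A (S v)) * norm v" by (rule norm_cauchy_schwarz)
    also have "\<dots> \<le> (norm A * norm (S v)) * norm v"
      by (intro mult_right_mono norm_blinfun norm_ge_zero)
    finally have "norm (S v) * norm (S v) \<le> (norm v * norm A) * norm (S v)"
      by (simp add: power2_eq_square algebra_simps)
    then show "norm (S v) \<le> norm v * norm A"
      by (cases "S v = 0") auto
  qed
  then have "blinfun_apply (Blinfun S) = S" by (rule bounded_linear_Blinfun_apply)
  then show ?thesis
    by (intro exI[of _ "Blinfun S"]) (simp add: cinner_adjoint_of_inner[OF A S])
qed

lemma op_adj_eqI:
  assumes "\<And>x y. cinner (blinfun_apply A x) y = cinner x (blinfun_apply S y)"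
  shows "op_adj A = S"
  unfolding op_adj_def
proof (rule the_equality)
  fix R assume R: "\<forall>x y. cinner (blinfun_apply A x) y = cinner x (blinfun_apply R y)"
  show "R = S"
  proof (rule blinfun_eqI, rule inner_eqI)
    fix x y
    have "cinner y (R x) = cinner y (S x)"
      by (rule trans[OF R[rule_format, symmetric] assms])
    from arg_cong[OF this, of Re] show "inner (R x) y = inner (S x) y"
      by (simp only: Re_cinner inner_commute[of y])
  qed
qed (simp only: assms simp_thms)

lemma cinner_op_adj:
  fixes A :: "'a::complex_hilbert \<Rightarrow>\<^sub>L 'b::complex_hilbert"
  assumes "A \<in> bounded_ops"
  shows "cinner (A x) y = cinner x (op_adj A y)"
proof -
  obtain S where S: "\<And>x y. cinner (A x) y = cinner x (blinfun_apply S y)"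
    using op_adj_exists[OF assms] by blast
  show ?thesis by (simp only: op_adj_eqI[of A S, OF S] S)
qed

lemma inner_op_adj:
  fixes A :: "'a::complex_hilbert \<Rightarrow>\<^sub>L 'b::complex_hilbert"
  assumes "A \<in> bounded_ops"
  shows "inner (A x) y = inner x (op_adj A y)"
  by (simp only: Re_cinner[symmetric] cinner_op_adj[OF assms])

lemma op_adj_in_bounded_ops:
  fixes A :: "'a::complex_hilbert \<Rightarrow>\<^sub>L 'b::complex_hilbert"
  assumes "A \<in> bounded_ops"
  shows "op_adj A \<in> bounded_ops"
proof (rule bounded_opsI)
  fix c x y
  have "cinner y (op_adj A (c *\<^sub>C x)) = cinner y (c *\<^sub>C op_adj A x)"
    by (simp add: cinner_op_adj[OF assms, symmetric] cinner_scaleC_right)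
  then show "inner (op_adj A (c *\<^sub>C x)) y = inner (c *\<^sub>C op_adj A x) y"
    by (metis Re_cinner inner_commute)
qed

subsection \<open>Functional calculus of positive operators\<close>

text \<open>The coercive operator \<open>Q = s (T - t)\<close> has a bounded inverse
  \<open>R\<close>, and \<open>s R\<close> inverts \<open>T - t\<close>. The factor \<open>s\<close>
  is a sign in the applications, for \<open>t\<close> below or above the values of the form.\<close>

lemma not_in_real_spectrum_if_coercive:
  fixes T :: "'a::complex_hilbert \<Rightarrow>\<^sub>L 'a"
  assumes T: "T \<in> bounded_ops" "symmetric_op T" and c: "c > 0"
    and coer: "\<And>x. c * (norm x)\<^sup>2 \<le> s * inner (T x - t *\<^sub>R x) x"
  shows "t \<notin> real_spectrum T"
proof -
  define Q where "Q = s *\<^sub>R (T - t *\<^sub>R id_blinfun)"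
  have Q: "Q x = s *\<^sub>R (T x - t *\<^sub>R x)" for x
    by (simp add: Q_def blinfun.bilinear_simps)
  have sym: "inner (Q x) y = inner x (Q y)" for x y
    by (simp add: Q inner_diff_left inner_diff_right symmetric_opD[OF T(2)])
  have low: "c * (norm x)\<^sup>2 \<le> inner (Q x) x" for x
    using coer[of x] by (simp add: Q)
  have "\<exists>x. Q x = y" for y
  proof -
    obtain x where "\<And>z. inner (Q x) z = inner y z"
      using coercive_representation[OF sym c low bounded_linear_inner_right[of y]] by blast
    then have "Q x = y" by (rule inner_eqI)
    then show ?thesis ..
  qed
  then obtain R where R: "\<And>y. Q (R y) = y" by metis
  have norm_le: "c * norm x \<le> norm (Q x)" for x
  proof (cases "x = 0")
    case False
    have "c * (norm x)\<^sup>2 \<le> norm (Q x) * norm x"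
      using low[of x] norm_cauchy_schwarz[of "Q x" x] by linarith
    then have "(c * norm x) * norm x \<le> norm (Q x) * norm x"
      by (simp add: power2_eq_square mult.assoc)
    then show ?thesis using False by simp
  qed simp
  have inj: "u = v" if "Q u = Q v" for u v
  proof -
    have "c * norm (u - v) \<le> 0"
      using norm_le[of "u - v"] that by (simp add: blinfun.bilinear_simps)
    then show ?thesis using c by (simp add: mult_le_0_iff)
  qed
  have Qc: "Q (z *\<^sub>C x) = z *\<^sub>C Q x" for z x
  proof (rule inner_eqI)
    fix y
    show "inner (Q (z *\<^sub>C x)) y = inner (z *\<^sub>C Q x) y"
      by (simp add: Q bounded_opsD[OF T(1)] inner_scaleC_swap inner_diff_left)
  qed
  have "bounded_linear R"
  proof (rule bounded_linear_intro)
    show "R (u + v) = R u + R v" for u v by (rule inj) (simp add: R blinfun.bilinear_simps)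
    show "R (a *\<^sub>R v) = a *\<^sub>R R v" for a v by (rule inj) (simp add: R blinfun.bilinear_simps)
    show "norm (R v) \<le> norm v * (1 / c)" for v
      using norm_le[of "R v"] c by (simp add: R field_simps)
  qed
  then have BR: "blinfun_apply (Blinfun R) = R" by (rule bounded_linear_Blinfun_apply)
  define S where "S = s *\<^sub>R Blinfun R"
  have S: "S y = s *\<^sub>R R y" for y by (simp add: S_def blinfun.bilinear_simps BR)
  \<comment> \<open>\<open>spectrum\<close> asks for a complex-linear inverse; linearity passes from
    \<open>Q\<close> to \<open>R\<close> by injectivity.\<close>
  have "S \<in> bounded_ops"
  proof (rule bounded_opsI)
    fix z x y
    have "R (z *\<^sub>C x) = z *\<^sub>C R x" by (rule inj) (simp add: R Qc)
    then show "inner (S (z *\<^sub>C x)) y = inner (z *\<^sub>C S x) y"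
      by (simp add: S inner_scaleC_swap)
  qed
  moreover have "S o\<^sub>L (T - scalar_op (complex_of_real t)) = id_blinfun"
  proof (rule blinfun_eqI)
    fix x
    have "s *\<^sub>R R (T x - t *\<^sub>R x) = R (Q x)"
      by (rule inj) (simp add: R blinfun.bilinear_simps, simp add: Q)
    also have "\<dots> = x" by (rule inj) (simp add: R)
    finally show "(S o\<^sub>L (T - scalar_op (complex_of_real t))) x = id_blinfun x"
      by (simp add: S scalar_op_of_real blinfun.diff_left blinfun.scaleR_left)
  qed
  moreover have "(T - scalar_op (complex_of_real t)) o\<^sub>L S = id_blinfun"
  proof (rule blinfun_eqI)
    fix x
    have "T (S x) - t *\<^sub>R S x = Q (R x)" by (simp add: S Q blinfun.bilinear_simps scaleR_diff_right)
    then show "((T - scalar_op (complex_of_real t)) o\<^sub>L S) x = id_blinfun x"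
      by (simp add: R scalar_op_of_real blinfun.diff_left blinfun.scaleR_left)
  qed
  ultimately show ?thesis by (auto simp: spectrum_def)
qed

definition positive_op :: "('a::complex_inner \<Rightarrow>\<^sub>L 'a) \<Rightarrow> bool"
  where "positive_op T \<longleftrightarrow> T \<in> bounded_ops \<and> symmetric_op T \<and> (\<forall>x. 0 \<le> inner (T x) x)"

text \<open>\<open>T - t\<close> is coercive for \<open>t < 0\<close>, and \<open>t - T\<close> for
  \<open>t > norm T\<close>. The compact interval makes Weierstrass approximation available.\<close>

lemma real_spectrum_positive_op:
  fixes T :: "'a::complex_hilbert \<Rightarrow>\<^sub>L 'a"
  assumes "positive_op T"
  shows "real_spectrum T \<subseteq> {0..norm T}"
proof
  have T: "T \<in> bounded_ops" "symmetric_op T" "\<And>x. 0 \<le> inner (T x) x"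
    using assms by (auto simp: positive_op_def)
  fix t assume t: "t \<in> real_spectrum T"
  have "0 \<le> t"
  proof (rule ccontr)
    assume "\<not> 0 \<le> t"
    then have "- t > 0" by simp
    then have "t \<notin> real_spectrum T"
      by (rule not_in_real_spectrum_if_coercive[OF T(1,2), where s = 1])
        (use T(3) in \<open>simp add: inner_diff_left power2_norm_eq_inner\<close>)
    then show False using t by simp
  qed
  moreover have "t \<le> norm T"
  proof (rule ccontr)
    assume "\<not> t \<le> norm T"
    then have "t - norm T > 0" by simp
    then have "t \<notin> real_spectrum T"
    proof (rule not_in_real_spectrum_if_coercive[OF T(1,2), where s = "- 1"])
      fix x
      have "inner (T x) x \<le> norm (T x) * norm x" by (rule norm_cauchy_schwarz)
      also have "\<dots> \<le> norm T * (norm x)\<^sup>2"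
        using mult_right_mono[OF norm_blinfun[of T x] norm_ge_zero[of x]]
        by (simp add: power2_eq_square mult.assoc)
      finally show "(t - norm T) * (norm x)\<^sup>2 \<le> - 1 * inner (T x - t *\<^sub>R x) x"
        by (simp add: inner_diff_left dot_square_norm algebra_simps)
    qed
    then show False using t by simp
  qed
  ultimately show "t \<in> {0..norm T}" by simp
qed

text \<open>By \<open>norm_poly_op_le\<close> the operators form a Cauchy sequence, and its limit
  does not depend on the chosen approximants, so the definite description in \<open>cfc\<close>
  denotes it.\<close>

lemma cfc_tendsto:
  fixes T :: "'a::complex_hilbert \<Rightarrow>\<^sub>L 'a"
  assumes T: "symmetric_op T"
    and p: "uniform_limit (real_spectrum T) (\<lambda>n. poly (p n)) f sequentially"
  shows "(\<lambda>n. poly_op (p n) T) \<longlonglongrightarrow> cfc f T"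
proof -
  \<comment> \<open>Two sequences are allowed so that one estimate gives both the Cauchy property
    and the independence of the limit.\<close>
  have close: "\<exists>N. \<forall>m\<ge>N. \<forall>n\<ge>N. norm (poly_op (q m) T - poly_op (q' n) T) < e"
    if "uniform_limit (real_spectrum T) (\<lambda>n. poly (q n)) f sequentially"
      "uniform_limit (real_spectrum T) (\<lambda>n. poly (q' n)) f sequentially" "e > 0" for q q' e
  proof -
    have "e / 4 > 0" using that by simp
    from eventually_conj[OF uniform_limitD[OF that(1) this] uniform_limitD[OF that(2) this]]
    obtain N where N: "\<And>n t. n \<ge> N \<Longrightarrow> t \<in> real_spectrum T \<Longrightarrow> dist (poly (q n) t) (f t) < e / 4"
      "\<And>n t. n \<ge> N \<Longrightarrow> t \<in> real_spectrum T \<Longrightarrow> dist (poly (q' n) t) (f t) < e / 4"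
      unfolding eventually_sequentially by blast
    have "norm (poly_op (q m - q' n) T) \<le> e / 2" if "m \<ge> N" "n \<ge> N" for m n
    proof (rule norm_poly_op_le[OF T])
      fix t assume t: "t \<in> real_spectrum T"
      show "\<bar>poly (q m - q' n) t\<bar> \<le> e / 2"
        using N(1)[OF \<open>m \<ge> N\<close> t] N(2)[OF \<open>n \<ge> N\<close> t] unfolding dist_real_def poly_diff by arith
    qed (use \<open>e > 0\<close> in simp)
    then show ?thesis using \<open>e > 0\<close>
      by (intro exI[of _ N]) (fastforce simp: poly_op_diff)
  qed
  have "Cauchy (\<lambda>n. poly_op (p n) T)"
    by (rule CauchyI) (rule close[OF p p])
  then obtain S where S: "(\<lambda>n. poly_op (p n) T) \<longlonglongrightarrow> S"
    using Cauchy_convergent convergent_def by blast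
  have S': "(\<lambda>n. poly_op (q n) T) \<longlonglongrightarrow> S"
    if q: "uniform_limit (real_spectrum T) (\<lambda>n. poly (q n)) f sequentially" for q
  proof -
    have "(\<lambda>n. poly_op (q n) T - poly_op (p n) T) \<longlonglongrightarrow> 0"
      by (rule LIMSEQ_I) (use close[OF q p] in fastforce)
    from tendsto_add[OF this S] show ?thesis by simp
  qed
  have "cfc f T = S" unfolding cfc_def
  proof (rule the_equality)
    show "\<forall>q. uniform_limit (real_spectrum T) (\<lambda>n. poly (q n)) f sequentially \<longrightarrow>
        (\<lambda>n. poly_op (q n) T) \<longlonglongrightarrow> S"
      using S' by blast
  next
    fix R
    assume "\<forall>q. uniform_limit (real_spectrum T) (\<lambda>n. poly (q n)) f sequentially \<longrightarrow>
        (\<lambda>n. poly_op (q n) T) \<longlonglongrightarrow> R"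
    \<comment> \<open>The given \<open>p\<close> forces uniqueness; without any approximating
      sequence the description would hold of every operator.\<close>
    then show "R = S" using p S LIMSEQ_unique by blast
  qed
  then show ?thesis using S by simp
qed

lemma uniform_poly_approximation:
  fixes f :: "real \<Rightarrow> real"
  assumes "compact K" "continuous_on K f"
  obtains p where "uniform_limit K (\<lambda>n. poly (p n)) f sequentially"
proof -
  have "\<exists>q. \<forall>t\<in>K. \<bar>f t - poly q t\<bar> < 1 / real (Suc n)" for n
  proof -
    obtain g where g: "real_polynomial_function g" "\<And>t. t \<in> K \<Longrightarrow> \<bar>f t - g t\<bar> < 1 / real (Suc n)"
      using Stone_Weierstrass_real_polynomial_function[OF assms, of "1 / real (Suc n)"] by auto
    obtain a N where "g = (\<lambda>t. \<Sum>i\<le>N. a i * t ^ i)"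
      using g(1) unfolding real_polynomial_function_iff_sum by blast
    then have "g t = poly (\<Sum>i\<le>N. monom (a i) i) t" for t
      by (simp add: poly_sum poly_monom)
    with g(2) show ?thesis by (intro exI[of _ "\<Sum>i\<le>N. monom (a i) i"]) auto
  qed
  then obtain p where p: "\<And>n t. t \<in> K \<Longrightarrow> \<bar>f t - poly (p n) t\<bar> < 1 / real (Suc n)" by metis
  show ?thesis
  proof (rule that, rule uniform_limitI)
    fix e :: real assume "e > 0"
    then obtain N where N: "1 / real (Suc N) < e" by (metis nat_approx_posE)
    have "dist (poly (p n) t) (f t) < e" if "n \<ge> N" "t \<in> K" for n t
    proof -
      have "1 / real (Suc n) \<le> 1 / real (Suc N)" using that by (simp add: frac_le)
      then show ?thesis using p[OF that(2), of n] N by (simp add: dist_real_def)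
    qed
    then show "\<forall>\<^sub>F n in sequentially. \<forall>t\<in>K. dist (poly (p n) t) (f t) < e"
      unfolding eventually_sequentially by blast
  qed
qed

lemma poly_op_in_bounded_ops:
  assumes "T \<in> bounded_ops"
  shows "poly_op p T \<in> bounded_ops"
proof (induction p)
  case 0
  show ?case by (rule bounded_opsI) (simp add: inner_scaleC_swap)
next
  case (pCons a p)
  show ?case
    by (rule bounded_opsI)
      (simp add: poly_op_pCons blinfun.add_left blinfun.scaleR_left bounded_opsD[OF assms]
        bounded_opsD[OF pCons(2)] inner_scaleC_swap inner_add_left)
qed

lemma cfc_approximation:
  fixes T :: "'a::complex_hilbert \<Rightarrow>\<^sub>L 'a"
  assumes T: "positive_op T" and f: "continuous_on {0..} f"
  obtains p where "uniform_limit (real_spectrum T) (\<lambda>n. poly (p n)) f sequentially"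
    "(\<lambda>n. poly_op (p n) T) \<longlonglongrightarrow> cfc f T"
proof -
  have "continuous_on {0..norm T} f" by (rule continuous_on_subset[OF f]) auto
  then obtain p where "uniform_limit {0..norm T} (\<lambda>n. poly (p n)) f sequentially"
    using uniform_poly_approximation[OF compact_Icc] by blast
  then have "uniform_limit (real_spectrum T) (\<lambda>n. poly (p n)) f sequentially"
    by (rule uniform_limit_on_subset) (rule real_spectrum_positive_op[OF T])
  moreover from this have "(\<lambda>n. poly_op (p n) T) \<longlonglongrightarrow> cfc f T"
    using T cfc_tendsto by (auto simp: positive_op_def)
  ultimately show ?thesis by (rule that)
qed

text \<open>Approximants of \<open>f\<close> eventually exceed \<open>q - e\<close> on the spectrum,
  so \<open>poly_op_nonneg\<close> applies with slack \<open>e\<close>, which then tends to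
  0.\<close>

lemma cfc_ge_poly_op:
  fixes T :: "'a::complex_hilbert \<Rightarrow>\<^sub>L 'a"
  assumes T: "positive_op T" and f: "continuous_on {0..} f"
    and le: "\<And>t. 0 \<le> t \<Longrightarrow> poly q t \<le> f t"
  shows "inner (poly_op q T x) x \<le> inner (cfc f T x) x"
proof -
  obtain p where p: "uniform_limit (real_spectrum T) (\<lambda>n. poly (p n)) f sequentially"
    "(\<lambda>n. poly_op (p n) T) \<longlonglongrightarrow> cfc f T"
    using cfc_approximation[OF T f] by blast
  have sym: "symmetric_op T" using T by (simp add: positive_op_def)
  have bound: "inner (poly_op q T x) x - e * (norm x)\<^sup>2 \<le> inner (cfc f T x) x" if e: "e > 0" for e
  proof (rule LIMSEQ_le_const)
    show "(\<lambda>n. inner (poly_op (p n) T x) x) \<longlonglongrightarrow> inner (cfc f T x) x"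
      by (intro tendsto_intros p(2))
    obtain N where N: "\<And>n t. n \<ge> N \<Longrightarrow> t \<in> real_spectrum T \<Longrightarrow> dist (poly (p n) t) (f t) < e"
      using uniform_limitD[OF p(1) e] unfolding eventually_sequentially by blast
    have "inner (poly_op q T x) x - e * (norm x)\<^sup>2 \<le> inner (poly_op (p n) T x) x" if "n \<ge> N" for n
    proof -
      have "0 \<le> inner (poly_op (p n - q + [:e:]) T x) x"
      proof (rule poly_op_nonneg[OF sym])
        fix t assume t: "t \<in> real_spectrum T"
        then have "poly q t \<le> f t"
          using real_spectrum_positive_op[OF T] by (intro le) auto
        then show "0 \<le> poly (p n - q + [:e:]) t"
          using N[OF \<open>n \<ge> N\<close> t] by (simp add: dist_real_def)
      qed
      then show ?thesis
        by (simp add: poly_op_add poly_op_diff poly_op_pCons blinfun.bilinear_simps inner_add_left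
            inner_diff_left dot_square_norm)
    qed
    then show "\<exists>N. \<forall>n\<ge>N. inner (poly_op q T x) x - e * (norm x)\<^sup>2 \<le> inner (poly_op (p n) T x) x"
      by blast
  qed
  show ?thesis
  proof (cases "x = 0")
    case False
    show ?thesis
    proof (rule field_le_epsilon)
      fix e :: real assume "e > 0"
      then have "e / (norm x)\<^sup>2 > 0" using False by simp
      from bound[OF this] show "inner (poly_op q T x) x \<le> inner (cfc f T x) x + e"
        using False by simp
    qed
  qed simp
qed

text \<open>Complex linearity and symmetry pass to the limit of the approximants; positivity is
  comparison with the zero polynomial.\<close>

lemma positive_op_cfc:
  fixes T :: "'a::complex_hilbert \<Rightarrow>\<^sub>L 'a"
  assumes T: "positive_op T" and f: "continuous_on {0..} f" and nonneg: "\<And>t. 0 \<le> t \<Longrightarrow> 0 \<le> f t"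
  shows "positive_op (cfc f T)"
  unfolding positive_op_def
proof (intro conjI allI)
  obtain p where p: "(\<lambda>n. poly_op (p n) T) \<longlonglongrightarrow> cfc f T"
    using cfc_approximation[OF T f] by blast
  have T': "symmetric_op T" "T \<in> bounded_ops" using T by (auto simp: positive_op_def)
  show "cfc f T \<in> bounded_ops"
  proof (rule bounded_opsI)
    fix c x y
    have "(\<lambda>n. inner (poly_op (p n) T (c *\<^sub>C x)) y) \<longlonglongrightarrow> inner (cfc f T (c *\<^sub>C x)) y"
      by (intro tendsto_intros p)
    moreover have "(\<lambda>n. inner (poly_op (p n) T x) (cnj c *\<^sub>C y)) \<longlonglongrightarrow> inner (cfc f T x) (cnj c *\<^sub>C y)"
      by (intro tendsto_intros p)
    ultimately show "inner (cfc f T (c *\<^sub>C x)) y = inner (c *\<^sub>C cfc f T x) y"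
      by (simp add: bounded_opsD[OF poly_op_in_bounded_ops[OF T'(2)]] inner_scaleC_swap LIMSEQ_unique)
  qed
  show "symmetric_op (cfc f T)" unfolding symmetric_op_def
  proof (intro allI)
    fix x y
    have "(\<lambda>n. inner (poly_op (p n) T x) y) \<longlonglongrightarrow> inner (cfc f T x) y"
      by (intro tendsto_intros p)
    moreover have "(\<lambda>n. inner x (poly_op (p n) T y)) \<longlonglongrightarrow> inner x (cfc f T y)"
      by (intro tendsto_intros p)
    ultimately show "inner (cfc f T x) y = inner x (cfc f T y)"
      by (simp add: symmetric_opD[OF symmetric_op_poly_op[OF T'(1)]] LIMSEQ_unique)
  qed
  show "0 \<le> inner (cfc f T x) x" for x
    using cfc_ge_poly_op[OF T f, of 0 x] nonneg by simp
qed

text \<open>The squares of approximants of \<open>f\<close> converge uniformly to the identity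
  function, and composition of operators is continuous.\<close>

lemma cfc_sqrt_squared:
  fixes T :: "'a::complex_hilbert \<Rightarrow>\<^sub>L 'a"
  assumes T: "positive_op T" and f: "continuous_on {0..} f" and sq: "\<And>t. 0 \<le> t \<Longrightarrow> f t * f t = t"
  shows "cfc f T o\<^sub>L cfc f T = T"
proof -
  obtain p where p: "uniform_limit (real_spectrum T) (\<lambda>n. poly (p n)) f sequentially"
    "(\<lambda>n. poly_op (p n) T) \<longlonglongrightarrow> cfc f T"
    using cfc_approximation[OF T f] by blast
  have sym: "symmetric_op T" using T by (simp add: positive_op_def)
  have sub: "real_spectrum T \<subseteq> {0..norm T}" by (rule real_spectrum_positive_op[OF T])
  \<comment> \<open>Boundedness of the limit is what makes products of uniformly convergent
    functions converge uniformly.\<close>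
  have "bounded (f ` {0..norm T})"
    by (intro compact_imp_bounded compact_continuous_image continuous_on_subset[OF f]) auto
  then have "bounded (f ` real_spectrum T)" by (rule bounded_subset) (use sub in blast)
  note uniform_lim_mult[OF p(1) p(1) this this]
  moreover have "poly (p n * p n) = (\<lambda>t. poly (p n) t * poly (p n) t)" for n
    by (rule ext) simp
  ultimately have "uniform_limit (real_spectrum T) (\<lambda>n. poly (p n * p n)) (\<lambda>t. f t * f t) sequentially"
    by simp
  then have "uniform_limit (real_spectrum T) (\<lambda>n. poly (p n * p n)) (\<lambda>t. t) sequentially"
    by (rule uniform_limit_cong'[THEN iffD1, rotated 2]) (use sub sq in auto)
  from cfc_tendsto[OF sym this]
  have "(\<lambda>n. poly_op (p n) T o\<^sub>L poly_op (p n) T) \<longlonglongrightarrow> cfc (\<lambda>t. t) T"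
    by (simp only: poly_op_mult)
  with bounded_bilinear.tendsto[OF bounded_bilinear_blinfun_compose p(2) p(2)]
  have "cfc f T o\<^sub>L cfc f T = cfc (\<lambda>t. t) T" by (rule LIMSEQ_unique)
  moreover have "uniform_limit (real_spectrum T) (\<lambda>n. poly [:0, 1:]) (\<lambda>t. t) sequentially"
    by (rule uniform_limitI) simp
  from LIMSEQ_unique[OF cfc_tendsto[OF sym this] tendsto_const]
  have "cfc (\<lambda>t. t) T = poly_op [:0, 1:] T" .
  moreover have "poly_op [:0, 1:] T = T"
    by (rule blinfun_eqI) (simp add: poly_op_pCons blinfun.bilinear_simps)
  ultimately show ?thesis by simp
qed

lemma continuous_on_powr_nonneg: "s > 0 \<Longrightarrow> continuous_on {0..} (\<lambda>t::real. t powr s)"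
  by (intro continuous_on_powr' continuous_intros) auto

text \<open>Positivity allows the functional calculus to be applied again to
  \<open>op_abs A\<close>; the square links it to \<open>norm (A x)\<close>.\<close>

lemma op_abs_positive_and_square:
  fixes A :: "'a::complex_hilbert \<Rightarrow>\<^sub>L 'b::complex_hilbert"
  assumes A: "A \<in> bounded_ops"
  shows "positive_op (op_abs A)" "op_abs A o\<^sub>L op_abs A = op_adj A o\<^sub>L A"
proof -
  have adj: "inner (op_adj A u) v = inner u (A v)" for u v
    by (simp add: inner_op_adj[OF A] inner_commute[of _ v] inner_commute[of u])
  have pos: "positive_op (op_adj A o\<^sub>L A)"
    unfolding positive_op_def symmetric_op_def bounded_ops_def
    by (simp add: bounded_opsD[OF A] bounded_opsD[OF op_adj_in_bounded_ops[OF A]] adj)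
      (simp add: inner_op_adj[OF A])
  have cont: "continuous_on {0..} (\<lambda>t::real. t powr (1/2))" by (rule continuous_on_powr_nonneg) simp
  show "positive_op (op_abs A)" unfolding op_abs_def op_powr_def
    by (rule positive_op_cfc[OF pos cont]) simp
  show "op_abs A o\<^sub>L op_abs A = op_adj A o\<^sub>L A" unfolding op_abs_def op_powr_def
    by (rule cfc_sqrt_squared[OF pos cont]) (simp add: powr_add[symmetric])
qed

subsection \<open>Powers of the absolute value\<close>

text \<open>The left side is the tangent of the \<open>r\<close>-th power at \<open>l\<close>. After
  scaling to \<open>u = t / l\<close>, this is Young's inequality for \<open>u powr r\<close> and 1
  with weights \<open>1 / r\<close> and \<open>1 - 1 / r\<close>.\<close>

lemma powr_tangent_le:
  fixes l r t :: real
  assumes r: "r \<ge> 1" and l: "l > 0" and t: "t \<ge> 0"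
  shows "(1 - r) * l powr r + r * l powr (r - 1) * t \<le> t powr r"
proof (cases "t = 0")
  case True
  then show ?thesis using r by (simp add: mult_nonpos_nonneg)
next
  case False
  with t have t: "t > 0" by simp
  define u where "u = t / l"
  have u: "u > 0" using t l by (simp add: u_def)
  have "(u powr r) powr (1 / r) * 1 powr (1 - 1 / r) \<le> 1 / r * u powr r + (1 - 1 / r) * 1"
    using r u by (intro Youngs_inequality_0) auto
  moreover have "(u powr r) powr (1 / r) = u" using r u by (simp add: powr_powr)
  ultimately have "r * u \<le> r * (1 / r * u powr r + (1 - 1 / r) * 1)"
    using r by (intro mult_left_mono) auto
  also have "\<dots> = u powr r + (r - 1)" using r by (simp add: field_simps)
  finally have "r * u + (1 - r) \<le> u powr r" by simp
  then have "(r * u + (1 - r)) * l powr r \<le> u powr r * l powr r"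
    by (rule mult_right_mono) simp
  moreover have "u powr r * l powr r = t powr r"
    using u l by (simp add: powr_mult[symmetric] u_def)
  moreover have "u * l powr r = l powr (r - 1) * t"
    using l by (simp add: u_def powr_diff)
  ultimately show ?thesis by (simp add: algebra_simps)
qed

text \<open>With the tangent taken in the variable \<open>t\<^sup>2\<close>, the minorant of
  \<open>t powr (2 * r)\<close> is a quadratic polynomial in \<open>op_abs A\<close>. No composition
  rule for powers of operators is involved.\<close>

lemma op_abs_powr_tangent:
  fixes A :: "'a::complex_hilbert \<Rightarrow>\<^sub>L 'b::complex_hilbert"
  assumes A: "A \<in> bounded_ops" and r: "r \<ge> 1" and l: "l > 0"
  shows "(1 - r) * l powr r * (norm x)\<^sup>2 + r * l powr (r - 1) * (norm (A x))\<^sup>2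
    \<le> inner (op_powr (op_abs A) (2 * r) x) x"
proof -
  define P where "P = op_abs A"
  define q where "q = [:(1 - r) * l powr r, 0, r * l powr (r - 1):]"
  have P: "positive_op P" "P o\<^sub>L P = op_adj A o\<^sub>L A"
    using op_abs_positive_and_square[OF A] by (simp_all add: P_def)
  have "inner (poly_op q P x) x \<le> inner (cfc (\<lambda>t. t powr (2 * r)) P x) x"
  proof (rule cfc_ge_poly_op[OF P(1)])
    fix t :: real assume t: "t \<ge> 0"
    have "t powr (2 * r) = (t\<^sup>2) powr r"
      using t by (simp add: powr_powr[symmetric])
    then show "poly q t \<le> t powr (2 * r)"
      using powr_tangent_le[OF r l, of "t\<^sup>2"] by (simp add: q_def power2_eq_square algebra_simps)
  qed (use r in \<open>auto intro: continuous_on_powr_nonneg\<close>)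
  moreover have "P (P x) = op_adj A (A x)"
    using arg_cong[OF P(2), of "\<lambda>S. blinfun_apply S x"] by simp
  then have "inner (P (P x)) x = (norm (A x))\<^sup>2"
    by (simp add: inner_commute[of _ x] inner_op_adj[OF A, symmetric] dot_square_norm)
  ultimately show ?thesis
    by (simp add: q_def P_def op_powr_def poly_op_pCons blinfun.bilinear_simps inner_add_left
        dot_square_norm)
qed

text \<open>
  McCarthy's inequality for the diagonal operator with entries \<open>A\<close> and \<open>D\<close>: the tangent is taken at
  the value \<open>l\<close> of the quadratic form itself.
\<close>

lemma op_abs_powr_pair_ge:
  fixes A D :: "'a::complex_hilbert \<Rightarrow>\<^sub>L 'a"
  assumes A: "A \<in> bounded_ops" and D: "D \<in> bounded_ops" and r: "r \<ge> 1"
    and xy: "(norm x)\<^sup>2 + (norm y)\<^sup>2 = 1"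
  shows "((norm (A x))\<^sup>2 + (norm (D y))\<^sup>2) powr r
    \<le> inner (op_powr (op_abs A) (2 * r) x) x + inner (op_powr (op_abs D) (2 * r) y) y"
proof -
  define l where "l = (norm (A x))\<^sup>2 + (norm (D y))\<^sup>2"
  have nonneg: "0 \<le> inner (op_powr (op_abs E) (2 * r) z) z" if "E \<in> bounded_ops"
    for E :: "'a \<Rightarrow>\<^sub>L 'a" and z
  proof -
    have "positive_op (cfc (\<lambda>t. t powr (2 * r)) (op_abs E))"
      using r by (intro positive_op_cfc op_abs_positive_and_square that continuous_on_powr_nonneg) auto
    then show ?thesis by (simp add: positive_op_def op_powr_def)
  qed
  show ?thesis
  proof (cases "l = 0")
    case True
    then show ?thesis using nonneg[OF A, of x] nonneg[OF D, of y] by (simp add: l_def)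
  next
    case False
    then have l: "l > 0" by (simp add: l_def less_le)
    \<comment> \<open>At total norm 1 the two tangent bounds add up to
      \<open>(1 - r) * l powr r + r * l powr (r - 1) * l\<close>, which is
      \<open>l powr r\<close>.\<close>
    have "p * ((norm x)\<^sup>2 + (norm y)\<^sup>2) + q * l
        = (p * (norm x)\<^sup>2 + q * (norm (A x))\<^sup>2) + (p * (norm y)\<^sup>2 + q * (norm (D y))\<^sup>2)" for p q
      by (simp add: l_def algebra_simps)
    from this[of "(1 - r) * l powr r" "r * l powr (r - 1)"]
    have "l powr r = ((1 - r) * l powr r * (norm x)\<^sup>2 + r * l powr (r - 1) * (norm (A x))\<^sup>2)
        + ((1 - r) * l powr r * (norm y)\<^sup>2 + r * l powr (r - 1) * (norm (D y))\<^sup>2)"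
      using l unfolding xy by (simp add: powr_diff left_diff_distrib)
    also have "\<dots> \<le> inner (op_powr (op_abs A) (2 * r) x) x + inner (op_powr (op_abs D) (2 * r) y) y"
      by (intro add_mono op_abs_powr_tangent A D r l)
    finally show ?thesis unfolding l_def .
  qed
qed

text \<open>Add the tangent inequalities at the midpoint \<open>l\<close> for \<open>u\<close> and
  \<open>v\<close>.\<close>

lemma powr_midpoint_convex:
  fixes u v r :: real
  assumes "r \<ge> 1" "u \<ge> 0" "v \<ge> 0"
  shows "((u + v) / 2) powr r \<le> (u powr r + v powr r) / 2"
proof (cases "u + v = 0")
  case False
  define l where "l = (u + v) / 2"
  have l: "l > 0" using False assms by (simp add: l_def)
  have uv: "u + v = 2 * l" by (simp add: l_def)
  have K: "l powr (r - 1) * l = l powr r" using l by (simp add: powr_diff)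
  have "r * l powr (r - 1) * u + r * l powr (r - 1) * v = r * l powr (r - 1) * (u + v)"
    by (simp add: distrib_left)
  also have "\<dots> = 2 * r * l powr r" by (simp add: uv K[symmetric])
  finally have "r * l powr (r - 1) * u + r * l powr (r - 1) * v = 2 * r * l powr r" .
  with powr_tangent_le[OF assms(1) l assms(2)] powr_tangent_le[OF assms(1) l assms(3)]
  show ?thesis by (simp add: l_def[symmetric] algebra_simps)
qed (use assms in auto)

subsection \<open>The numerical radius\<close>

text \<open>Reflecting \<open>a\<close> in the line through \<open>e\<close> preserves its norm; apply Cauchy-Schwarz to the result.\<close>

lemma buzano:
  fixes a b e :: "'a::complex_inner"
  assumes e: "norm e = 1"
  shows "cmod (cinner a e) * cmod (cinner e b) \<le> (norm a * norm b + cmod (cinner a b)) / 2"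
proof -
  define k where "k = cinner a e"
  define w where "w = (2 * k) *\<^sub>C e - a"
  have "inner (k *\<^sub>C e) a = (cmod k)\<^sup>2"
  proof -
    have "cinner (k *\<^sub>C e) a = k * cnj k"
      by (simp add: cinner_scaleC_left k_def) (metis cinner_commute)
    then show ?thesis by (simp add: Re_cinner[symmetric] complex_mult_cnj cmod_power2)
  qed
  moreover have "inner ((2 * k) *\<^sub>C e) a = 2 * inner (k *\<^sub>C e) a"
    by (simp add: Re_cinner[symmetric] cinner_scaleC_left)
  ultimately have "(norm w)\<^sup>2 = (norm a)\<^sup>2"
    by (simp add: w_def power2_norm_eq_inner inner_diff_left inner_diff_right
        inner_commute[of a "(2 * k) *\<^sub>C e"])
      (simp add: dot_square_norm norm_scaleC e norm_mult power2_eq_square)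
  then have w: "norm w = norm a" by simp
  have "w + a = (2 * k) *\<^sub>C e" by (simp add: w_def)
  then have "cinner w b + cinner a b = 2 * k * cinner e b"
    by (metis cinner_add_left cinner_scaleC_left)
  then have "2 * (cmod k * cmod (cinner e b)) = cmod (cinner w b + cinner a b)"
    by (simp add: norm_mult)
  also have "\<dots> \<le> cmod (cinner w b) + cmod (cinner a b)" by (rule norm_triangle_ineq)
  also have "\<dots> \<le> norm a * norm b + cmod (cinner a b)"
    using norm_cinner_le[of w b] by (simp add: w)
  finally show ?thesis by (simp add: k_def)
qed

text \<open>The operator norm bounds the set, so \<open>Sup\<close> is a genuine supremum; the
  inserted 0 gives the sign.\<close>

lemma numerical_radius_nonneg: "0 \<le> numerical_radius A"
  and norm_cinner_le_numerical_radius_unit: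
    "norm x = 1 \<Longrightarrow> cmod (cinner (blinfun_apply A x) x) \<le> numerical_radius A"
proof -
  have "cmod (cinner (blinfun_apply A x) x) \<le> norm A" if "norm x = 1" for x
    using norm_cinner_le[of "A x" x] norm_blinfun[of A x] that by simp
  then have "bdd_above (insert 0 {cmod (cinner (blinfun_apply A x) x) | x. norm x = 1})"
    by (intro bdd_aboveI[of _ "norm A"]) auto
  then show "0 \<le> numerical_radius A"
    "norm x = 1 \<Longrightarrow> cmod (cinner (blinfun_apply A x) x) \<le> numerical_radius A"
    unfolding numerical_radius_def by (auto intro!: cSup_upper)
qed

lemma norm_cinner_le_numerical_radius:
  assumes A: "A \<in> bounded_ops"
  shows "cmod (cinner (blinfun_apply A x) x) \<le> numerical_radius A * (norm x)\<^sup>2"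
proof (cases "x = 0")
  case True
  then show ?thesis using norm_cinner_le[of "A x" x] by simp
next
  case False
  define u where "u = (1 / norm x) *\<^sub>R x"
  have x: "x = complex_of_real (norm x) *\<^sub>C u" using False by (simp add: u_def scaleC_of_real)
  have "cinner (A x) x = complex_of_real (norm x) * complex_of_real (norm x) * cinner (A u) u"
    by (subst (1 2) x)
      (simp add: bounded_opsD[OF A] cinner_scaleC_left cinner_scaleC_right)
  then have "cmod (cinner (A x) x) = cmod (cinner (A u) u) * (norm x)\<^sup>2"
    by (simp add: norm_mult power2_eq_square)
  moreover have "norm u = 1" using False by (simp add: u_def)
  ultimately show ?thesis
    by (simp add: mult_right_mono norm_cinner_le_numerical_radius_unit)
qed

text \<open>Replacing \<open>K\<close> by \<open>K powr (1 / s)\<close> removes the power before the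
  supremum is taken; \<open>K \<ge> 0\<close> allows the return to \<open>K\<close>.\<close>

lemma numerical_radius_powr_le:
  assumes s: "s > 0" and K: "K \<ge> 0"
    and le: "\<And>x. norm x = 1 \<Longrightarrow> cmod (cinner (blinfun_apply A x) x) powr s \<le> K"
  shows "numerical_radius A powr s \<le> K"
proof -
  have "cmod (cinner (blinfun_apply A x) x) \<le> K powr (1 / s)" if "norm x = 1" for x
    using powr_mono2[OF _ _ le[OF that], of "1 / s"] s by (simp add: powr_powr)
  then have "numerical_radius A \<le> K powr (1 / s)"
    unfolding numerical_radius_def by (intro cSup_least) auto
  from powr_mono2[OF _ numerical_radius_nonneg this, of s]
  show ?thesis using s K by (simp add: powr_powr)
qed

text \<open>The two vectors are the images of \<open>(x, y)\<close> under the operator matrix and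
  its adjoint. The pair inequality is applied to \<open>C\<close>, \<open>B\<close> and to
  \<open>op_adj B\<close>, \<open>op_adj C\<close>; regrouping by \<open>x\<close> and
  \<open>y\<close> produces the two norms, and \<open>2 u v \<le> u\<^sup>2 + v\<^sup>2\<close> the
  factor 1/2.\<close>

lemma op_abs_powr_norm_bound:
  fixes B C :: "'a::complex_hilbert \<Rightarrow>\<^sub>L 'a"
  assumes B: "B \<in> bounded_ops" and C: "C \<in> bounded_ops" and r: "r \<ge> 1"
    and xy: "(norm x)\<^sup>2 + (norm y)\<^sup>2 = 1"
    and M: "norm (op_powr (op_abs C) (2 * r) + op_powr (op_abs (op_adj B)) (2 * r)) \<le> M"
      "norm (op_powr (op_abs B) (2 * r) + op_powr (op_abs (op_adj C)) (2 * r)) \<le> M"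
  shows "(norm (B y, C x) * norm (op_adj C y, op_adj B x)) powr r \<le> M / 2"
proof -
  define a b where "a = norm (B y, C x)" and "b = norm (op_adj C y, op_adj B x)"
  have ab: "a \<ge> 0" "b \<ge> 0" by (simp_all add: a_def b_def)
  have adj: "op_adj B \<in> bounded_ops" "op_adj C \<in> bounded_ops"
    using B C by (auto intro: op_adj_in_bounded_ops)
  have quad: "inner (S z) z \<le> M * (norm z)\<^sup>2" if "norm S \<le> M" for S :: "'a \<Rightarrow>\<^sub>L 'a" and z
  proof -
    have "inner (S z) z \<le> norm (S z) * norm z" by (rule norm_cauchy_schwarz)
    also have "\<dots> \<le> (norm S * norm z) * norm z" by (intro mult_right_mono norm_blinfun norm_ge_zero)
    also have "\<dots> \<le> (M * norm z) * norm z" using that by (intro mult_right_mono) auto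
    finally show ?thesis by (simp add: power2_eq_square mult.assoc)
  qed
  have a2: "a\<^sup>2 = (norm (C x))\<^sup>2 + (norm (B y))\<^sup>2"
    and b2: "b\<^sup>2 = (norm (op_adj B x))\<^sup>2 + (norm (op_adj C y))\<^sup>2"
    by (simp_all add: a_def b_def norm_Pair)
  have "(a\<^sup>2) powr r + (b\<^sup>2) powr r \<le>
      (inner (op_powr (op_abs C) (2 * r) x) x + inner (op_powr (op_abs B) (2 * r) y) y) +
      (inner (op_powr (op_abs (op_adj B)) (2 * r) x) x + inner (op_powr (op_abs (op_adj C)) (2 * r) y) y)"
    unfolding a2 b2 by (intro add_mono op_abs_powr_pair_ge B C adj r xy)
  also have "\<dots> = inner ((op_powr (op_abs C) (2 * r) + op_powr (op_abs (op_adj B)) (2 * r)) x) x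
      + inner ((op_powr (op_abs B) (2 * r) + op_powr (op_abs (op_adj C)) (2 * r)) y) y"
    by (simp add: blinfun.add_left inner_add_left)
  also have "\<dots> \<le> M * (norm x)\<^sup>2 + M * (norm y)\<^sup>2"
    by (intro add_mono quad M)
  also have "\<dots> = M" by (simp add: distrib_left[symmetric] xy)
  finally have "(a\<^sup>2) powr r + (b\<^sup>2) powr r \<le> M" .
  moreover have "(c\<^sup>2) powr r = (c powr r)\<^sup>2" if "c \<ge> 0" for c :: real
    using that by (simp add: power2_eq_square powr_mult)
  ultimately have "(a powr r)\<^sup>2 + (b powr r)\<^sup>2 \<le> M" using ab by simp
  moreover have "2 * (a powr r) * (b powr r) \<le> (a powr r)\<^sup>2 + (b powr r)\<^sup>2"
    by (rule sum_squares_bound)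
  ultimately have "(a * b) powr r \<le> M / 2" using ab by (simp add: powr_mult)
  then show ?thesis by (simp add: a_def b_def)
qed

theorem theorem3p14:
  fixes B C :: "'a::complex_hilbert \<Rightarrow>\<^sub>L 'a"
    and \<beta> \<gamma>\<^sub>1 \<gamma>\<^sub>2 r :: real
  assumes "B \<in> bounded_ops" and "C \<in> bounded_ops"
    and "\<beta> \<ge> 0" and "r \<ge> 1"
    and "\<gamma>\<^sub>1 = (2 * \<beta> + 1) / (\<beta> + 1)"
    and "\<gamma>\<^sub>2 = (2 * \<beta> + 3) / (\<beta> + 1)"
  shows "numerical_radius (op_matrix 0 B C 0) powr (4 * r) \<le>
    \<gamma>\<^sub>1 / 16 *
      max ((norm (op_powr (op_abs C) (2 * r) + op_powr (op_abs (op_adj B)) (2 * r)))\<^sup>2)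
          ((norm (op_powr (op_abs B) (2 * r) + op_powr (op_abs (op_adj C)) (2 * r)))\<^sup>2)
    + \<gamma>\<^sub>2 / 8 *
      max (norm (op_powr (op_abs C) (2 * r) + op_powr (op_abs (op_adj B)) (2 * r)))
          (norm (op_powr (op_abs B) (2 * r) + op_powr (op_abs (op_adj C)) (2 * r))) *
      max (numerical_radius (B o\<^sub>L C) powr r) (numerical_radius (C o\<^sub>L B) powr r)"
proof -
  note B = assms(1) and C = assms(2) and r = assms(4)
  define m\<^sub>1 where "m\<^sub>1 = norm (op_powr (op_abs C) (2 * r) + op_powr (op_abs (op_adj B)) (2 * r))"
  define m\<^sub>2 where "m\<^sub>2 = norm (op_powr (op_abs B) (2 * r) + op_powr (op_abs (op_adj C)) (2 * r))"
  define M where "M = max m\<^sub>1 m\<^sub>2"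
  define w where "w = max (numerical_radius (B o\<^sub>L C)) (numerical_radius (C o\<^sub>L B))"
  define W where "W = max (numerical_radius (B o\<^sub>L C) powr r) (numerical_radius (C o\<^sub>L B) powr r)"
  have m: "m\<^sub>1 \<ge> 0" "m\<^sub>2 \<ge> 0" by (simp_all add: m\<^sub>1_def m\<^sub>2_def)
  have M: "M \<ge> 0" using m by (simp add: M_def)
  have W: "W \<ge> 0" by (simp add: W_def max_def)
  have w: "w \<ge> 0" using numerical_radius_nonneg by (auto simp: w_def le_max_iff_disj)
  have wW: "w powr r \<le> W" by (simp add: w_def W_def max_def)
  have bound: "(norm (B y, C x) * norm (op_adj C y, op_adj B x)) powr r \<le> M / 2"
    if "(norm x)\<^sup>2 + (norm y)\<^sup>2 = 1" for x y
    by (rule op_abs_powr_norm_bound[OF B C r that]) (simp_all add: M_def m\<^sub>1_def m\<^sub>2_def)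
  have BC: "cinner (B (C x)) x = cinner (C x) (op_adj B x)" for x
    by (rule cinner_op_adj[OF B])
  have CB: "cinner (C (B y)) y = cinner (B y) (op_adj C y)" for y
    by (rule cinner_op_adj[OF C])
  \<comment> \<open>Vectors with one zero component reduce \<open>bound\<close> to a single product;
    this yields \<open>W \<le> M / 2\<close>.\<close>
  have "numerical_radius (B o\<^sub>L C) powr r \<le> M / 2"
  proof (rule numerical_radius_powr_le)
    fix x :: 'a assume x: "norm x = 1"
    have "cmod (cinner ((B o\<^sub>L C) x) x) powr r \<le> (norm (C x) * norm (op_adj B x)) powr r"
      using r by (intro powr_mono2) (simp_all add: BC norm_cinner_le)
    also have "\<dots> \<le> M / 2" using bound[of x 0] x by (simp add: norm_Pair)
    finally show "cmod (cinner ((B o\<^sub>L C) x) x) powr r \<le> M / 2" .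
  qed (use r M in auto)
  moreover have "numerical_radius (C o\<^sub>L B) powr r \<le> M / 2"
  proof (rule numerical_radius_powr_le)
    fix y :: 'a assume y: "norm y = 1"
    have "cmod (cinner ((C o\<^sub>L B) y) y) powr r \<le> (norm (B y) * norm (op_adj C y)) powr r"
      using r by (intro powr_mono2) (simp_all add: CB norm_cinner_le)
    also have "\<dots> \<le> M / 2" using bound[of 0 y] y by (simp add: norm_Pair)
    finally show "cmod (cinner ((C o\<^sub>L B) y) y) powr r \<le> M / 2" .
  qed (use r M in auto)
  ultimately have WM: "W \<le> M / 2" by (simp add: W_def)
  have comp: "B o\<^sub>L C \<in> bounded_ops" "C o\<^sub>L B \<in> bounded_ops"
    unfolding bounded_ops_def by (simp_all add: bounded_opsD[OF B] bounded_opsD[OF C])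
  have "numerical_radius (op_matrix 0 B C 0) powr (2 * r) \<le> M / 4 + W / 2"
  proof (rule numerical_radius_powr_le)
    fix z :: "'a \<times> 'a" assume z: "norm z = 1"
    obtain x y where xy: "z = (x, y)" by fastforce
    have norm_xy: "(norm x)\<^sup>2 + (norm y)\<^sup>2 = 1"
      using z by (simp add: xy norm_Pair)
    \<comment> \<open>These are the images of \<open>z\<close> under the matrix and its adjoint, so
      \<open>cinner a b\<close> is the form of the squared matrix at \<open>z\<close>.\<close>
    define a b where "a = (B y, C x)" and "b = (op_adj C y, op_adj B x)"
    have "op_matrix 0 B C 0 z = a" by (simp add: op_matrix.rep_eq xy a_def)
    moreover have "cinner z b = cinner a z"
      by (simp add: xy a_def b_def cinner_prod_def cinner_op_adj[OF B, symmetric]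
          cinner_op_adj[OF C, symmetric])
    ultimately have sq: "(cmod (cinner (op_matrix 0 B C 0 z) z))\<^sup>2
        \<le> (norm a * norm b + cmod (cinner a b)) / 2"
      using buzano[OF z, of a b] by (simp add: power2_eq_square)
    have "cinner a b = cinner ((C o\<^sub>L B) y) y + cinner ((B o\<^sub>L C) x) x"
      by (simp add: a_def b_def cinner_prod_def BC CB)
    also have "cmod \<dots> \<le> cmod (cinner ((C o\<^sub>L B) y) y) + cmod (cinner ((B o\<^sub>L C) x) x)"
      by (rule norm_triangle_ineq)
    also have "\<dots> \<le> numerical_radius (C o\<^sub>L B) * (norm y)\<^sup>2 + numerical_radius (B o\<^sub>L C) * (norm x)\<^sup>2"
      by (intro add_mono norm_cinner_le_numerical_radius comp)
    also have "\<dots> \<le> w * (norm y)\<^sup>2 + w * (norm x)\<^sup>2"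
      by (intro add_mono mult_right_mono) (simp_all add: w_def)
    also have "\<dots> = w" using norm_xy by (simp add: distrib_left[symmetric] add.commute)
    finally have "cmod (cinner a b) powr r \<le> w powr r"
      using r by (intro powr_mono2) auto
    then have ab: "cmod (cinner a b) powr r \<le> W" using wW by simp
    have "cmod (cinner (op_matrix 0 B C 0 z) z) powr (2 * r)
        = ((cmod (cinner (op_matrix 0 B C 0 z) z))\<^sup>2) powr r"
      by (simp add: powr_powr[symmetric])
    also have "\<dots> \<le> ((norm a * norm b + cmod (cinner a b)) / 2) powr r"
      using r sq by (intro powr_mono2) auto
    also have "\<dots> \<le> ((norm a * norm b) powr r + cmod (cinner a b) powr r) / 2"
      using r by (intro powr_midpoint_convex) auto
    also have "\<dots> \<le> M / 4 + W / 2"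
      using bound[OF norm_xy] ab by (simp add: a_def b_def)
    finally show "cmod (cinner (op_matrix 0 B C 0 z) z) powr (2 * r) \<le> M / 4 + W / 2" .
  qed (use r M W in auto)
  then have "(numerical_radius (op_matrix 0 B C 0) powr (2 * r))\<^sup>2 \<le> (M / 4 + W / 2)\<^sup>2"
    by (rule power_mono) simp
  moreover have "(numerical_radius (op_matrix 0 B C 0) powr (2 * r))\<^sup>2
      = numerical_radius (op_matrix 0 B C 0) powr (4 * r)"
    by (simp add: power2_eq_square powr_add[symmetric])
  \<comment> \<open>\<open>W \<le> M / 2\<close> enters here: it makes the second factor of the
    difference nonnegative.\<close>
  moreover have "(M / 4 + W / 2)\<^sup>2 \<le> \<gamma>\<^sub>1 / 16 * M\<^sup>2 + \<gamma>\<^sub>2 / 8 * M * W"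
  proof -
    define s where "s = \<beta> / (\<beta> + 1)"
    have s: "s \<ge> 0" using assms(3) by (simp add: s_def)
    have \<gamma>: "\<gamma>\<^sub>1 = 1 + s" "\<gamma>\<^sub>2 = 3 - s"
      using assms(3) unfolding assms(5,6) s_def by (simp_all add: field_simps)
    have "0 \<le> (s * M / 8 + W / 4) * (M / 2 - W)"
      using s M W WM by (intro mult_nonneg_nonneg) auto
    also have "\<dots> = \<gamma>\<^sub>1 / 16 * M\<^sup>2 + \<gamma>\<^sub>2 / 8 * M * W - (M / 4 + W / 2)\<^sup>2"
      by (simp add: \<gamma> power2_eq_square field_simps)
    finally show ?thesis by simp
  qed
  moreover have "max (m\<^sub>1\<^sup>2) (m\<^sub>2\<^sup>2) = M\<^sup>2"
    using m by (auto simp: M_def max_def power_mono_iff abs_le_square_iff[symmetric])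
  ultimately show ?thesis
    unfolding m\<^sub>1_def[symmetric] m\<^sub>2_def[symmetric] M_def[symmetric] W_def[symmetric] by simp
qed

end
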